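(* A $\kappa$-Borel space $(X,\mathscr{B})$ is standard if and only if there is a (regular Hausdorff) topology $\tau$ on $X$ such that (1) $(X,\tau)$ is an $f\mathrm{SC}_\kappa$-space, and (2) $\mathrm{Bor}_\kappa(X,\tau)=\mathscr{B}$. Moreover, condition (1) can equivalently be replaced by (1$'$) $(X,\tau)$ is a $\kappa$-additive $\mathrm{SC}_\kappa$-space.
   Context: Work in ZFC; $\kappa$ is an uncountable regular cardinal with $2^{<\kappa}=\kappa$ (equivalently $\kappa^{<\kappa}=\kappa$). "Space" means regular Hausdorff topological space. ${}^{\kappa}\kappa$ is the set of all functions $\kappa\to\kappa$ with the bounded topology, generated by the sets $\{x\in{}^{\kappa}\kappa \mid s\subseteq x\}$, $s\in{}^{<\kappa}\kappa$. A $\kappa^+$-algebra on $X$ is a family of subsets closed under complements and unions of size $\le\kappa$. $\mathrm{Bor}_\kappa(X,\tau)$ is the smallest $\kappa^+$-algebra containing $\tau$; its elements are the $\kappa$-Borel subsets of $(X,\tau)$. A $\kappa$-Borel space is a pair $(X,\mathscr{B})$ with $\mathscr{B}$ a $\kappa^+$-algebra on $X$ that separates points and is generated as a $\kappa^+$-algebra by a family of size $\le\kappa$. A $\kappa$-Borel isomorphism between $(X,\mathscr{B})$ and $(X',\mathscr{B}')$ is a bijection $f$ with $f^{-1}(B')\in\mathscr{B}$ for $B'\in\mathscr{B}'$ and $f(B)\in\mathscr{B}'$ for $B\in\mathscr{B}$. $(X,\mathscr{B})$ is standard if it is $\kappa$-Borel isomorphic to some $B\in\mathrm{Bor}_\kappa({}^{\kappa}\kappa)$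 equipped with $\{B\cap A\mid A\in\mathrm{Bor}_\kappa({}^{\kappa}\kappa)\}$. A space is $\kappa$-additive if its topology is closed under intersections of fewer than $\kappa$ open sets. Choquet games on $X$: players I and II play $\kappa$-many rounds. In round $\alpha<\kappa$, I plays $(U_\alpha,x_\alpha)$ with $U_\alpha$ a relatively open subset of $\bigcap_{\beta<\alpha}V_\beta$ (which is $X$ if $\alpha=0$) and $x_\alpha\in U_\alpha$; then II plays a relatively open subset $V_\alpha$ of $\bigcap_{\beta<\alpha}V_\beta$ with $x_\alpha\in V_\alpha\subseteq U_\alpha$. In the strong $\kappa$-Choquet game $\mathrm{G}^s_\kappa(X)$, II wins iff $\bigcap_{\alpha<\gamma}V_\alpha\ne\emptyset$ for every limit $\gamma\le\kappa$ (I wins as soon as such an intersection is empty). In the strong fair $\kappa$-Choquet game $f\mathrm{G}^s_\kappa(X)$, if $\bigcap_{\alpha<\gamma}V_\alpha=\emptyset$ for some limit $\gamma<\kappa$ the run ends and II wins; if the run lasts $\kappa$ rounds, II wins iff $\bigcap_{\alpha<\kappa}V_\alpha\ne\emptyset$. $X$ is an $\mathrm{SC}_\kappa$-space (resp. $f\mathrm{SC}_\kappa$-space) if it has weight $\le\kappa$ and II has a winning strategy in $\mathrm{G}^s_\kappa(X)$ (resp. $f\mathrm{G}^s_\kappa(X)$). *)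

theory Defs
  imports "HOL-Analysis.Analysis"
begin

unbundle cardinal_syntax

text \<open>
  The cardinal \<open>\<kappa>\<close> is given by a well-ordered type \<open>'k\<close>, whose elements are the ordinals below
  \<open>\<kappa>\<close>. A parameter \<open>K :: 'k itself\<close> (always instantiated with \<open>TYPE('k)\<close>) stands for \<open>\<kappa>\<close> in the
  definitions below. The ordinal \<open>\<alpha> < \<kappa>\<close> as a set is \<open>{..<\<alpha>}\<close>, and \<open>\<kappa>\<close> as a set is \<open>UNIV\<close>.
\<close>

definition kappa :: "'k::wellorder itself \<Rightarrow> 'k rel"
  where "kappa K = {(a, b). a \<le> b}"

text \<open>
  The last clause is \<open>2\<^sup><\<^sup>\<kappa> = \<kappa>\<close>: the set of all binary sequences of length less than \<open>\<kappa>\<close>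
  has cardinality \<open>\<kappa>\<close>.
\<close>

definition admissible :: "'k::wellorder itself \<Rightarrow> bool"
  where "admissible K \<longleftrightarrow>
    Card_order (kappa K) \<and> natLeq <o kappa K \<and> regularCard (kappa K) \<and>
    |SIGMA \<alpha>:(UNIV :: 'k set). {..<\<alpha>} \<rightarrow>\<^sub>E (UNIV :: bool set)| =o kappa K"

section \<open>Borel structures\<close>

definition kplus_algebra :: "'k::wellorder itself \<Rightarrow> 'a set \<Rightarrow> 'a set set \<Rightarrow> bool"
  where "kplus_algebra K X \<B> \<longleftrightarrow>
    \<B> \<subseteq> Pow X \<and>
    (\<forall>A\<in>\<B>. X - A \<in> \<B>) \<and>
    (\<forall>\<F>. \<F> \<subseteq> \<B> \<and> |\<F>| \<le>o kappa K \<longrightarrow> \<Union>\<F> \<in> \<B>)"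

definition generated_kplus_algebra :: "'k::wellorder itself \<Rightarrow> 'a set \<Rightarrow> 'a set set \<Rightarrow> 'a set set"
  where "generated_kplus_algebra K X \<G> = \<Inter>{\<B>. kplus_algebra K X \<B> \<and> \<G> \<subseteq> \<B>}"

definition Bor :: "'k::wellorder itself \<Rightarrow> 'a topology \<Rightarrow> 'a set set"
  where "Bor K \<tau> = generated_kplus_algebra K (topspace \<tau>) {U. openin \<tau> U}"

definition kBorel_space :: "'k::wellorder itself \<Rightarrow> 'a set \<Rightarrow> 'a set set \<Rightarrow> bool"
  where "kBorel_space K X \<B> \<longleftrightarrow>
    kplus_algebra K X \<B> \<and>
    (\<forall>x\<in>X. \<forall>y\<in>X. x \<noteq> y \<longrightarrow> (\<exists>B\<in>\<B>. x \<in> B \<and> y \<notin> B)) \<and>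
    (\<exists>\<G>. \<G> \<subseteq> Pow X \<and> |\<G>| \<le>o kappa K \<and> generated_kplus_algebra K X \<G> = \<B>)"

definition kBorel_isomorphism ::
    "'a set \<Rightarrow> 'a set set \<Rightarrow> 'b set \<Rightarrow> 'b set set \<Rightarrow> ('a \<Rightarrow> 'b) \<Rightarrow> bool"
  where "kBorel_isomorphism X \<B> X' \<B>' f \<longleftrightarrow>
    bij_betw f X X' \<and> (\<forall>B'\<in>\<B>'. f -` B' \<inter> X \<in> \<B>) \<and> (\<forall>B\<in>\<B>. f ` B \<in> \<B>')"

text \<open>
  A sequence in \<open>\<^sup><\<^sup>\<kappa>\<kappa>\<close> is represented by its length \<open>\<alpha>\<close> and any total function \<open>s\<close> extending it.
\<close>

definition bounded_topology :: "('k::wellorder \<Rightarrow> 'k) topology"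
  where "bounded_topology = topology_generated_by {{x. \<forall>\<beta><\<alpha>. x \<beta> = s \<beta>} | \<alpha> s. True}"

definition standard_kBorel :: "'k::wellorder itself \<Rightarrow> 'a set \<Rightarrow> 'a set set \<Rightarrow> bool"
  where "standard_kBorel K X \<B> \<longleftrightarrow>
    (\<exists>B \<in> Bor K (bounded_topology :: ('k \<Rightarrow> 'k) topology). \<exists>f.
       kBorel_isomorphism X \<B> B {B \<inter> A | A. A \<in> Bor K (bounded_topology :: ('k \<Rightarrow> 'k) topology)} f)"

section \<open>Topological notions\<close>

definition weight_le :: "'k::wellorder itself \<Rightarrow> 'a topology \<Rightarrow> bool"
  where "weight_le K \<tau> \<longleftrightarrow>
    (\<exists>\<U>. |\<U>| \<le>o kappa K \<and> (\<forall>V\<in>\<U>. openin \<tau> V) \<and>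
      (\<forall>U x. openin \<tau> U \<and> x \<in> U \<longrightarrow> (\<exists>V\<in>\<U>. x \<in> V \<and> V \<subseteq> U)))"

definition kadditive :: "'k::wellorder itself \<Rightarrow> 'a topology \<Rightarrow> bool"
  where "kadditive K \<tau> \<longleftrightarrow>
    (\<forall>\<F>. (\<forall>U\<in>\<F>. openin \<tau> U) \<and> |\<F>| <o kappa K \<longrightarrow> openin \<tau> (topspace \<tau> \<inter> \<Inter>\<F>))"

section \<open>Choquet games\<close>

text \<open>
  In a run, \<open>m \<alpha> = (U\<^sub>\<alpha>, x\<^sub>\<alpha>)\<close> is the move of I and \<open>V \<alpha>\<close> that of II in round \<open>\<alpha>\<close>. The
  intersection of the \<open>V \<alpha>\<close> over \<open>\<alpha> \<in> D\<close> is taken inside the space, so it is the whole space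
  when \<open>D\<close> is empty.
\<close>

definition meet :: "'a topology \<Rightarrow> ('k::wellorder \<Rightarrow> 'a set) \<Rightarrow> 'k set \<Rightarrow> 'a set"
  where "meet \<tau> V D = topspace \<tau> \<inter> (\<Inter>\<alpha>\<in>D. V \<alpha>)"

definition legal_I ::
    "'a topology \<Rightarrow> ('k::wellorder \<Rightarrow> 'a set \<times> 'a) \<Rightarrow> ('k \<Rightarrow> 'a set) \<Rightarrow> 'k \<Rightarrow> bool"
  where "legal_I \<tau> m V \<alpha> \<longleftrightarrow>
    openin (subtopology \<tau> (meet \<tau> V {..<\<alpha>})) (fst (m \<alpha>)) \<and> snd (m \<alpha>) \<in> fst (m \<alpha>)"

definition legal_II ::
    "'a topology \<Rightarrow> ('k::wellorder \<Rightarrow> 'a set \<times> 'a) \<Rightarrow> ('k \<Rightarrow> 'a set) \<Rightarrow> 'k \<Rightarrow> bool"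
  where "legal_II \<tau> m V \<alpha> \<longleftrightarrow>
    openin (subtopology \<tau> (meet \<tau> V {..<\<alpha>})) (V \<alpha>) \<and> snd (m \<alpha>) \<in> V \<alpha> \<and> V \<alpha> \<subseteq> fst (m \<alpha>)"

text \<open>
  A strategy \<open>\<sigma>\<close> for II yields the move in round \<open>\<alpha>\<close> from the moves of I in rounds \<open>\<beta> \<le> \<alpha>\<close>; the
  previous moves of II are determined by these.
\<close>

type_synonym ('k, 'a) strategy = "'k \<Rightarrow> ('k \<Rightarrow> 'a set \<times> 'a) \<Rightarrow> 'a set"

text \<open>
  \<open>run_by \<tau> \<sigma> m V D\<close>: rounds \<open>\<alpha> \<in> D\<close> (\<open>D\<close> an initial segment of \<open>\<kappa>\<close>) were played with I moving
  legally and II following \<open>\<sigma>\<close>. Values of \<open>m\<close> and \<open>V\<close> outside \<open>D\<close> are irrelevant.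
\<close>

definition run_by ::
    "'a topology \<Rightarrow> ('k::wellorder, 'a) strategy \<Rightarrow> ('k \<Rightarrow> 'a set \<times> 'a) \<Rightarrow> ('k \<Rightarrow> 'a set) \<Rightarrow> 'k set \<Rightarrow> bool"
  where "run_by \<tau> \<sigma> m V D \<longleftrightarrow>
    (\<forall>\<alpha>\<in>D. legal_I \<tau> m V \<alpha> \<and> V \<alpha> = \<sigma> \<alpha> (restrict m {..\<alpha>}))"

definition legal_strategy :: "'a topology \<Rightarrow> ('k::wellorder, 'a) strategy \<Rightarrow> bool"
  where "legal_strategy \<tau> \<sigma> \<longleftrightarrow> (\<forall>m V \<alpha>. run_by \<tau> \<sigma> m V {..\<alpha>} \<longrightarrow> legal_II \<tau> m V \<alpha>)"

definition is_limit :: "'k::wellorder \<Rightarrow> bool"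
  where "is_limit \<gamma> \<longleftrightarrow> (\<exists>\<alpha>. \<alpha> < \<gamma>) \<and> (\<forall>\<alpha><\<gamma>. \<exists>\<beta>. \<alpha> < \<beta> \<and> \<beta> < \<gamma>)"

text \<open>
  If the intersection is empty at some limit \<open>\<gamma> < \<kappa>\<close>, then I has no legal move in round \<open>\<gamma>\<close>, so
  the run does not extend to all of \<open>UNIV\<close>. This is a win for II in the fair game, and it is
  excluded by the first clause on the intersections in the strong game.
\<close>

definition winning_fair :: "'a topology \<Rightarrow> ('k::wellorder, 'a) strategy \<Rightarrow> bool"
  where "winning_fair \<tau> \<sigma> \<longleftrightarrow>
    legal_strategy \<tau> \<sigma> \<and> (\<forall>m V. run_by \<tau> \<sigma> m V UNIV \<longrightarrow> meet \<tau> V UNIV \<noteq> {})"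

definition winning_strong :: "'a topology \<Rightarrow> ('k::wellorder, 'a) strategy \<Rightarrow> bool"
  where "winning_strong \<tau> \<sigma> \<longleftrightarrow>
    legal_strategy \<tau> \<sigma> \<and>
    (\<forall>m V \<gamma>. is_limit \<gamma> \<and> run_by \<tau> \<sigma> m V {..<\<gamma>} \<longrightarrow> meet \<tau> V {..<\<gamma>} \<noteq> {}) \<and>
    (\<forall>m V. run_by \<tau> \<sigma> m V UNIV \<longrightarrow> meet \<tau> V UNIV \<noteq> {})"

text \<open>Spaces are regular Hausdorff by convention.\<close>

definition SC_space :: "'k::wellorder itself \<Rightarrow> 'a topology \<Rightarrow> bool"
  where "SC_space K \<tau> \<longleftrightarrow>
    regular_space \<tau> \<and> Hausdorff_space \<tau> \<and> weight_le K \<tau> \<and>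
    (\<exists>\<sigma> :: ('k, 'a) strategy. winning_strong \<tau> \<sigma>)"

definition fSC_space :: "'k::wellorder itself \<Rightarrow> 'a topology \<Rightarrow> bool"
  where "fSC_space K \<tau> \<longleftrightarrow>
    regular_space \<tau> \<and> Hausdorff_space \<tau> \<and> weight_le K \<tau> \<and>
    (\<exists>\<sigma> :: ('k, 'a) strategy. winning_fair \<tau> \<sigma>)"

end

theory Submission
  imports Defs
begin

text \<open>
  Every additive \<open>SC\<^sub>\<kappa>\<close>-topology is an \<open>fSC\<^sub>\<kappa>\<close>-topology, because a strategy that wins the
  strong game also wins the fair one. So two implications carry the theorem.

  \<^emph>\<open>From a fair strategy to a standard space.\<close> Let II have a winning strategy in the fair game. Build a
  tree of runs: at a position \<open>P\<close>, that is, at the intersection of the previous moves of II, let I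
  choose among \<open>\<kappa>\<close> many moves such that the answers of II cover \<open>P\<close>; the weight makes this
  possible. A function \<open>y : \<kappa> \<rightarrow> \<kappa>\<close> selects one run. In round \<open>\<alpha>\<close> the moves of I also
  settle the relation to one pair of basic sets, so that by regularity the positions along a run form
  a neighbourhood base at any point in their intersection. If all positions along \<open>y\<close> are
  nonempty, the run lasts \<open>\<kappa>\<close> rounds and the fair strategy provides a point, which is unique.
  Such \<open>y\<close> form a closed set, and the point depends continuously on \<open>y\<close>. Conversely, a point gets an
  address by always taking the least index whose answer contains it. The address map is Borel and
  the point map inverts it, so its range consists of the \<open>y\<close> that are fixed by ``address of the
  point of \<open>y\<close>''. This is a Borel condition, and the address map is a Borel isomorphism
  (\<open>fSC_imp_standard\<close>). Borel measurability rests on the fact that an answer of II is relatively open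
  in an intersection of fewer than \<open>\<kappa>\<close> previous answers.

  \<^emph>\<open>From a standard space to an additive strong Choquet topology.\<close> Every Borel set \<open>A\<close> of
  \<open>\<^sup>\<kappa>\<kappa>\<close> has a Borel function with closed graph from one coordinate of which membership in \<open>A\<close>
  can be read off (\<open>Bor_captured\<close>). Adjoining its values identifies a standard space with a closed
  subset \<open>C\<close> of \<open>\<^sup>\<kappa>\<kappa>\<close>. In the strong game II may lose on \<open>C\<close>, since a sequence of limit
  length all of whose initial segments extend into \<open>C\<close> need not itself extend into \<open>C\<close>. Adding one
  branch above each minimal sequence that does not extend into \<open>C\<close> removes the obstacle (\<open>superclosed_extension\<close>). By
  \<open>\<kappa>\<^sup><\<^sup>\<kappa> = \<kappa>\<close> at most \<open>\<kappa>\<close> points are added, and a change on \<open>\<kappa>\<close> many points does not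
  affect the Borel structure (\<open>superclosed_representation\<close>). In the resulting set, II wins by
  answering with basic neighbourhoods.
\<close>
section \<open>The cardinal \<open>\<kappa>\<close>\<close>

locale admissible_cardinal =
  fixes K :: "'k::wellorder itself"
  assumes admissible: "admissible K"
begin

lemma Card_order_kappa: "Card_order (kappa K)"
  and natLeq_less_kappa: "natLeq <o kappa K"
  and regular_kappa: "regularCard (kappa K)"
  and binary_sequences:
    "|SIGMA \<alpha>:(UNIV :: 'k set). {..<\<alpha>} \<rightarrow>\<^sub>E (UNIV :: bool set)| =o kappa K"
  using admissible by (auto simp: admissible_def)

lemma Field_kappa: "Field (kappa K) = UNIV"
  by (auto simp: kappa_def Field_def)

lemma card_UNIV: "|UNIV :: 'k set| =o kappa K"
  using card_of_Field_ordIso[OF Card_order_kappa] by (simp add: Field_kappa)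

lemma card_UNIV_le: "|A| \<le>o kappa K \<longleftrightarrow> |A| \<le>o |UNIV :: 'k set|"
  using card_UNIV ordIso_symmetric ordLeq_ordIso_trans by blast

lemma infinite_kappa: "infinite (UNIV :: 'k set)"
  using infinite_iff_natLeq_ordLeq ordLess_imp_ordLeq[OF natLeq_less_kappa]
    ordIso_symmetric[OF card_UNIV] ordLeq_ordIso_trans by blast

lemma Cinfinite_kappa: "Cinfinite (kappa K)"
  using Card_order_kappa infinite_kappa by (simp add: cinfinite_def Field_kappa)

lemma le_kappa_subset: "A \<subseteq> B \<Longrightarrow> |B| \<le>o kappa K \<Longrightarrow> |A| \<le>o kappa K"
  using card_of_mono1 ordLeq_transitive by blast

lemma le_kappa_image: "|A| \<le>o kappa K \<Longrightarrow> |f ` A| \<le>o kappa K"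
  using card_of_image ordLeq_transitive by blast

lemma le_kappa_index: "|A :: 'k set| \<le>o kappa K"
  using card_UNIV_le card_of_mono1[of A UNIV] by blast

lemma le_kappa_Un: "|A| \<le>o kappa K \<Longrightarrow> |B| \<le>o kappa K \<Longrightarrow> |A \<union> B| \<le>o kappa K"
  using Un_Cinfinite_bound Cinfinite_kappa by blast

lemma le_kappa_Times: "|A| \<le>o kappa K \<Longrightarrow> |B| \<le>o kappa K \<Longrightarrow> |A \<times> B| \<le>o kappa K"
  using card_of_Times_ordLeq_infinite_Field[of "kappa K" A B] Card_order_kappa
  by (simp add: Field_kappa infinite_kappa)

lemma finite_less_kappa: "finite A \<Longrightarrow> |A| <o kappa K"
  using finite_ordLess_infinite[OF card_of_Well_order, of "kappa K" A] Card_order_kappa infinite_kappa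
  by (simp add: Field_kappa Field_card_of card_order_on_def)

lemma le_kappa_finite: "finite A \<Longrightarrow> |A| \<le>o kappa K"
  using finite_less_kappa ordLess_imp_ordLeq by blast

lemma kappa_enumeration:
  assumes "|A| \<le>o kappa K" "A \<noteq> {}"
  obtains f :: "'k \<Rightarrow> _" where "range f = A"
  using card_of_ordLeq2[OF assms(2), of "UNIV :: 'k set"] assms(1) card_UNIV_le by blast

lemma card_initial_segment: "|{..<\<alpha> :: 'k}| <o kappa K"
proof -
  have "underS (kappa K) \<alpha> = {..<\<alpha>}"
    by (auto simp: underS_def kappa_def)
  then show ?thesis
    using card_of_underS[OF Card_order_kappa, of \<alpha>] by (simp add: Field_kappa)
qed

lemma no_top: "\<exists>\<beta>. (\<alpha>::'k) < \<beta>"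
proof (rule ccontr)
  assume "\<nexists>\<beta>. \<alpha> < \<beta>"
  then have "(UNIV :: 'k set) = insert \<alpha> {..<\<alpha>}"
    by (auto simp: not_less order.order_iff_strict)
  moreover have "|{..<\<alpha>} \<union> {\<alpha>}| <o kappa K"
    using card_initial_segment finite_less_kappa[of "{\<alpha>}"]
    by (intro Un_Cinfinite_bound_strict Cinfinite_kappa) auto
  ultimately show False
    using card_UNIV by (metis Un_insert_right sup_bot_right not_ordLess_ordIso)
qed

text \<open>
  This is the only form in which regularity of \<open>\<kappa>\<close> is used below.
\<close>

lemma bounded_if_small:
  assumes "|S :: 'k set| <o kappa K"
  shows "\<exists>\<alpha>. \<forall>\<beta>\<in>S. \<beta> < \<alpha>"
proof -
  have "\<not> cofinal S (kappa K)"
    using regular_kappa assms not_ordLess_ordIso unfolding regularCard_def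
    by (auto simp: Field_kappa)
  then obtain \<gamma> where \<gamma>: "\<And>\<beta>. \<beta> \<in> S \<Longrightarrow> \<beta> \<le> \<gamma>"
    unfolding cofinal_def by (auto simp: Field_kappa kappa_def) (metis nle_le)
  obtain \<alpha> where "\<gamma> < \<alpha>"
    using no_top by blast
  then show ?thesis
    using \<gamma> le_less_trans by blast
qed

lemma small_image: "|A| <o kappa K \<Longrightarrow> |f ` A| <o kappa K"
  using card_of_image ordLeq_ordLess_trans by blast

lemma pairing: obtains p :: "'k \<times> 'k \<Rightarrow> 'k" where "bij p"
  using card_of_Times_same_infinite[OF infinite_kappa] card_of_ordIso[of "UNIV :: ('k \<times> 'k) set"]
  by (metis UNIV_Times_UNIV)

text \<open>
  \<open>\<kappa>\<^sup><\<^sup>\<kappa> = \<kappa>\<close>: the graph of a sequence of length \<open>\<alpha> < \<kappa>\<close> is coded by a subset of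
  \<open>\<kappa>\<close> of size less than \<open>\<kappa>\<close>. By regularity this subset is bounded, hence it is given by a
  binary sequence of length less than \<open>\<kappa>\<close>.
\<close>

lemma le_kappa_sequences: "|range (\<lambda>(\<alpha>::'k, s::'k \<Rightarrow> 'k). (\<alpha>, restrict s {..<\<alpha>}))| \<le>o kappa K"
proof -
  obtain p :: "'k \<times> 'k \<Rightarrow> 'k" where p: "bij p"
    using pairing .
  define B where "B = (SIGMA \<delta>:(UNIV :: 'k set). {..<\<delta>} \<rightarrow>\<^sub>E (UNIV :: bool set))"
  define decode where "decode = (\<lambda>(\<alpha>::'k, \<delta>::'k, t).
    (\<alpha>, \<lambda>\<beta>\<in>{..<\<alpha>}. SOME \<gamma>. p (\<beta>, \<gamma>) < \<delta> \<and> t (p (\<beta>, \<gamma>))))"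
  have "(\<alpha>, restrict s {..<\<alpha>}) \<in> decode ` (UNIV \<times> B)" for \<alpha> :: 'k and s :: "'k \<Rightarrow> 'k"
  proof -
    have "|(\<lambda>\<beta>. p (\<beta>, s \<beta>)) ` {..<\<alpha>}| <o kappa K"
      by (rule small_image[OF card_initial_segment])
    from bounded_if_small[OF this] obtain \<delta> where \<delta>: "\<And>\<beta>. \<beta> < \<alpha> \<Longrightarrow> p (\<beta>, s \<beta>) < \<delta>"
      by auto
    define t where "t = (\<lambda>\<eta>\<in>{..<\<delta>}. \<exists>\<beta><\<alpha>. \<eta> = p (\<beta>, s \<beta>))"
    have t: "p (\<beta>, \<gamma>) < \<delta> \<and> t (p (\<beta>, \<gamma>)) \<longleftrightarrow> \<gamma> = s \<beta>" if "\<beta> < \<alpha>" for \<beta> \<gamma>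
      using \<delta> that by (auto simp: t_def inj_eq[OF bij_is_inj[OF p]])
    have "(\<delta>, t) \<in> B"
      by (auto simp: B_def t_def)
    moreover have "decode (\<alpha>, \<delta>, t) = (\<alpha>, restrict s {..<\<alpha>})"
      using t by (auto simp: decode_def intro!: restrict_ext)
    ultimately show ?thesis
      by (intro image_eqI[of _ _ "(\<alpha>, \<delta>, t)"]) auto
  qed
  then have "range (\<lambda>(\<alpha>::'k, s::'k \<Rightarrow> 'k). (\<alpha>, restrict s {..<\<alpha>})) \<subseteq> decode ` (UNIV \<times> B)"
    by auto
  moreover have "|decode ` (UNIV \<times> B)| \<le>o kappa K"
    using ordIso_imp_ordLeq[OF binary_sequences] unfolding B_def
    by (rule le_kappa_image[OF le_kappa_Times[OF le_kappa_index]])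
  ultimately show ?thesis
    by (rule le_kappa_subset)
qed

end

section \<open>Algebras closed under unions of size \<open>\<kappa>\<close>\<close>

context admissible_cardinal
begin

lemma kplus_algebra_subset: "kplus_algebra K X \<B> \<Longrightarrow> A \<in> \<B> \<Longrightarrow> A \<subseteq> X"
  and kplus_algebra_compl: "kplus_algebra K X \<B> \<Longrightarrow> A \<in> \<B> \<Longrightarrow> X - A \<in> \<B>"
  by (auto simp: kplus_algebra_def)

lemma kplus_algebra_UN:
  assumes "kplus_algebra K X \<B>" "|I| \<le>o kappa K" "\<And>i. i \<in> I \<Longrightarrow> A i \<in> \<B>"
  shows "(\<Union>i\<in>I. A i) \<in> \<B>"
proof -
  have "A ` I \<subseteq> \<B> \<and> |A ` I| \<le>o kappa K"
    using assms(2,3) le_kappa_image by blast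
  then show ?thesis
    using assms(1) unfolding kplus_algebra_def by blast
qed

lemma kplus_algebra_INT:
  assumes "kplus_algebra K X \<B>" "|I| \<le>o kappa K" "\<And>i. i \<in> I \<Longrightarrow> A i \<in> \<B>"
  shows "X \<inter> (\<Inter>i\<in>I. A i) \<in> \<B>"
proof -
  have "X \<inter> (\<Inter>i\<in>I. A i) = X - (\<Union>i\<in>I. X - A i)"
    by blast
  then show ?thesis
    using assms(3) kplus_algebra_compl[OF assms(1)] kplus_algebra_UN[OF assms(1,2), of "\<lambda>i. X - A i"]
    by presburger
qed

lemma kplus_algebra_empty: "kplus_algebra K X \<B> \<Longrightarrow> {} \<in> \<B>"
  using kplus_algebra_UN[of X \<B> "{}"] le_kappa_finite[of "{}"] by simp

lemma kplus_algebra_space: "kplus_algebra K X \<B> \<Longrightarrow> X \<in> \<B>"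
  using kplus_algebra_compl[OF _ kplus_algebra_empty] by fastforce

lemma kplus_algebra_Un:
  assumes "kplus_algebra K X \<B>" "A \<in> \<B>" "B \<in> \<B>"
  shows "A \<union> B \<in> \<B>"
  using kplus_algebra_UN[OF assms(1), of "{A, B}" "\<lambda>C. C"] assms le_kappa_finite[of "{A, B}"] by auto

lemma kplus_algebra_Diff:
  assumes "kplus_algebra K X \<B>" "A \<in> \<B>" "B \<in> \<B>"
  shows "A - B \<in> \<B>"
proof -
  have "A - B = X - ((X - A) \<union> B)"
    using assms kplus_algebra_subset by blast
  then show ?thesis
    using assms by (simp add: kplus_algebra_compl kplus_algebra_Un)
qed

lemma kplus_algebra_Int:
  assumes "kplus_algebra K X \<B>" "A \<in> \<B>" "B \<in> \<B>"
  shows "A \<inter> B \<in> \<B>"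
  using kplus_algebra_Diff[OF assms(1,2) kplus_algebra_Diff[OF assms]] by (simp add: Int_Diff double_diff Diff_Diff_Int)

end

lemma kplus_algebra_generated:
  assumes "\<G> \<subseteq> Pow X"
  shows "kplus_algebra K X (generated_kplus_algebra K X \<G>)"
proof -
  have "kplus_algebra K X (Pow X)"
    by (auto simp: kplus_algebra_def)
  then have "generated_kplus_algebra K X \<G> \<subseteq> Pow X"
    using assms unfolding generated_kplus_algebra_def by (intro Inter_lower) simp
  moreover have "X - A \<in> generated_kplus_algebra K X \<G>" if "A \<in> generated_kplus_algebra K X \<G>" for A
    using that unfolding generated_kplus_algebra_def by (auto simp: kplus_algebra_def)
  moreover have "\<Union>\<F> \<in> generated_kplus_algebra K X \<G>"
    if "\<F> \<subseteq> generated_kplus_algebra K X \<G>" "|\<F>| \<le>o kappa K" for \<F>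
    unfolding generated_kplus_algebra_def
  proof clarify
    fix \<B> assume \<B>: "kplus_algebra K X \<B>" "\<G> \<subseteq> \<B>"
    then have "\<F> \<subseteq> \<B>"
      using that(1) unfolding generated_kplus_algebra_def by blast
    then show "\<Union>\<F> \<in> \<B>"
      using \<B>(1) that(2) unfolding kplus_algebra_def by blast
  qed
  ultimately show ?thesis
    unfolding kplus_algebra_def[of K X "generated_kplus_algebra K X \<G>"] by blast
qed

lemma kplus_algebra_Bor: "kplus_algebra K (topspace \<tau>) (Bor K \<tau>)"
  unfolding Bor_def by (rule kplus_algebra_generated) (auto dest: openin_subset)

lemma open_in_Bor: "openin \<tau> U \<Longrightarrow> U \<in> Bor K \<tau>"
  unfolding Bor_def generated_kplus_algebra_def by blast

lemma Bor_least:
  "kplus_algebra K (topspace \<tau>) \<C> \<Longrightarrow> (\<And>U. openin \<tau> U \<Longrightarrow> U \<in> \<C>) \<Longrightarrow> Bor K \<tau> \<subseteq> \<C>"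
  unfolding Bor_def generated_kplus_algebra_def by blast

lemma (in admissible_cardinal) kplus_algebra_preimages:
  assumes alg: "kplus_algebra K Y \<A>" and f: "\<And>y. y \<in> Y \<Longrightarrow> f y \<in> X"
  shows "kplus_algebra K X {A. A \<subseteq> X \<and> f -` A \<inter> Y \<in> \<A>}"
  unfolding kplus_algebra_def
proof (intro conjI ballI allI impI)
  fix A assume A: "A \<in> {A. A \<subseteq> X \<and> f -` A \<inter> Y \<in> \<A>}"
  have "f -` (X - A) \<inter> Y = Y - (f -` A \<inter> Y)"
    using f by auto
  then show "X - A \<in> {A. A \<subseteq> X \<and> f -` A \<inter> Y \<in> \<A>}"
    using A kplus_algebra_Diff[OF alg kplus_algebra_space[OF alg]] by simp
next
  fix \<F> assume \<F>: "\<F> \<subseteq> {A. A \<subseteq> X \<and> f -` A \<inter> Y \<in> \<A>} \<and> |\<F>| \<le>o kappa K"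
  have "f -` (\<Union>\<F>) \<inter> Y = (\<Union>A\<in>\<F>. f -` A \<inter> Y)"
    by auto
  moreover have "(\<Union>A\<in>\<F>. f -` A \<inter> Y) \<in> \<A>"
    using \<F> by (intro kplus_algebra_UN[OF alg]) auto
  ultimately show "\<Union>\<F> \<in> {A. A \<subseteq> X \<and> f -` A \<inter> Y \<in> \<A>}"
    using \<F> by auto
qed auto

text \<open>
  The sets with measurable preimage form an algebra, so it suffices to look at open sets.
\<close>

lemma (in admissible_cardinal) Bor_preimage:
  assumes "kplus_algebra K Y \<A>" "\<And>y. y \<in> Y \<Longrightarrow> f y \<in> topspace \<tau>"
    and "\<And>U. openin \<tau> U \<Longrightarrow> f -` U \<inter> Y \<in> \<A>" "A \<in> Bor K \<tau>"
  shows "f -` A \<inter> Y \<in> \<A>"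
  using Bor_least[OF kplus_algebra_preimages[OF assms(1), of f "topspace \<tau>"]] assms
  by (auto dest: openin_subset)

lemma (in admissible_cardinal) kplus_algebra_below:
  assumes alg: "kplus_algebra K Y \<A>" and D: "D \<in> \<A>"
  shows "kplus_algebra K D {A \<in> \<A>. A \<subseteq> D}"
  unfolding kplus_algebra_def
proof (intro conjI ballI allI impI)
  fix \<F> assume "\<F> \<subseteq> {A \<in> \<A>. A \<subseteq> D} \<and> |\<F>| \<le>o kappa K"
  then show "\<Union>\<F> \<in> {A \<in> \<A>. A \<subseteq> D}"
    using kplus_algebra_UN[OF alg, of \<F> "\<lambda>A. A"] by auto
qed (auto intro: kplus_algebra_Diff[OF alg D])

lemma (in admissible_cardinal) Bor_pullback_topology:
  assumes g: "\<And>x. x \<in> X \<Longrightarrow> g x \<in> topspace \<tau>"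
  shows "Bor K (pullback_topology X g \<tau>) = {g -` A \<inter> X | A. A \<in> Bor K \<tau>}"
proof
  have top: "topspace (pullback_topology X g \<tau>) = X"
    using g by (auto simp: topspace_pullback_topology)
  show "{g -` A \<inter> X | A. A \<in> Bor K \<tau>} \<subseteq> Bor K (pullback_topology X g \<tau>)"
  proof clarify
    fix A assume "A \<in> Bor K \<tau>"
    show "g -` A \<inter> X \<in> Bor K (pullback_topology X g \<tau>)"
    proof (rule Bor_preimage[OF _ g _ \<open>A \<in> Bor K \<tau>\<close>])
      show "kplus_algebra K X (Bor K (pullback_topology X g \<tau>))"
        using kplus_algebra_Bor[of K "pullback_topology X g \<tau>"] by (simp add: top)
    qed (auto simp: openin_pullback_topology intro!: open_in_Bor)
  qed
  show "Bor K (pullback_topology X g \<tau>) \<subseteq> {g -` A \<inter> X | A. A \<in> Bor K \<tau>}"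
  proof (rule Bor_least)
    show "kplus_algebra K (topspace (pullback_topology X g \<tau>)) {g -` A \<inter> X | A. A \<in> Bor K \<tau>}"
      unfolding top kplus_algebra_def
    proof (intro conjI ballI allI impI)
      fix A assume "A \<in> {g -` A \<inter> X | A. A \<in> Bor K \<tau>}"
      then obtain B where B: "A = g -` B \<inter> X" "B \<in> Bor K \<tau>"
        by blast
      then have "X - A = g -` (topspace \<tau> - B) \<inter> X"
        using g by auto
      then show "X - A \<in> {g -` A \<inter> X | A. A \<in> Bor K \<tau>}"
        using kplus_algebra_Diff[OF kplus_algebra_Bor kplus_algebra_space[OF kplus_algebra_Bor] B(2)]
        by blast
    next
      fix \<F> assume \<F>: "\<F> \<subseteq> {g -` A \<inter> X | A. A \<in> Bor K \<tau>} \<and> |\<F>| \<le>o kappa K"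
      then have "\<forall>A\<in>\<F>. \<exists>B. A = g -` B \<inter> X \<and> B \<in> Bor K \<tau>"
        by blast
      then obtain B where B: "\<forall>A\<in>\<F>. A = g -` B A \<inter> X \<and> B A \<in> Bor K \<tau>"
        by metis
      then have "\<Union>\<F> = g -` (\<Union>A\<in>\<F>. B A) \<inter> X"
        by blast
      moreover have "(\<Union>A\<in>\<F>. B A) \<in> Bor K \<tau>"
        using \<F> B by (intro kplus_algebra_UN[OF kplus_algebra_Bor]) auto
      ultimately show "\<Union>\<F> \<in> {g -` A \<inter> X | A. A \<in> Bor K \<tau>}"
        by blast
    qed auto
  qed (auto simp: openin_pullback_topology intro: open_in_Bor)
qed

section \<open>The space \<open>\<^sup>\<kappa>\<kappa>\<close>\<close>

definition agree :: "'k::ord \<Rightarrow> ('k \<Rightarrow> 'b) \<Rightarrow> ('k \<Rightarrow> 'b) \<Rightarrow> bool"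
  where "agree \<alpha> x y \<longleftrightarrow> (\<forall>\<beta><\<alpha>. x \<beta> = y \<beta>)"

lemma agree_refl [simp]: "agree \<alpha> x x"
  and agree_sym: "agree \<alpha> x y \<Longrightarrow> agree \<alpha> y x"
  and agree_trans: "agree \<alpha> x y \<Longrightarrow> agree \<alpha> y z \<Longrightarrow> agree \<alpha> x z"
  by (auto simp: agree_def)

lemma agree_mono: "agree \<alpha> x y \<Longrightarrow> \<beta> \<le> \<alpha> \<Longrightarrow> agree \<beta> x y" for \<alpha> :: "'k::preorder"
  by (auto simp: agree_def intro: less_le_trans)

lemma openin_bounded_topology:
  "openin (bounded_topology :: ('k::wellorder \<Rightarrow> 'k) topology) U \<longleftrightarrow>
    (\<forall>x\<in>U. \<exists>\<alpha>. {y. agree \<alpha> y x} \<subseteq> U)"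
  (is "_ \<longleftrightarrow> ?R U")
proof
  assume "openin (bounded_topology :: ('k \<Rightarrow> 'k) topology) U"
  then have "generate_topology_on {{x :: 'k \<Rightarrow> 'k. \<forall>\<beta><\<alpha>. x \<beta> = s \<beta>} | \<alpha> s. True} U"
    by (simp add: bounded_topology_def openin_topology_generated_by_iff)
  then show "?R U"
  proof induction
    case (Int a b)
    show ?case
    proof
      fix x assume "x \<in> a \<inter> b"
      then obtain \<alpha> \<beta> where "{y. agree \<alpha> y x} \<subseteq> a" "{y. agree \<beta> y x} \<subseteq> b"
        using Int.IH by blast
      then have "{y. agree (max \<alpha> \<beta>) y x} \<subseteq> a \<inter> b"
        using agree_mono[of "max \<alpha> \<beta>"] max.cobounded1 max.cobounded2 by blast
      then show "\<exists>\<alpha>. {y. agree \<alpha> y x} \<subseteq> a \<inter> b" ..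
    qed
  next
    case (UN K)
    then show ?case
      by (meson UnionE Union_upper order_trans)
  next
    case (Basis s)
    then show ?case
      by (fastforce simp: agree_def)
  qed simp
next
  assume R: "?R U"
  have basic: "openin (bounded_topology :: ('k \<Rightarrow> 'k) topology) {y. agree \<alpha> y x}" for \<alpha> x
    unfolding bounded_topology_def agree_def by (rule topology_generated_by_Basis) blast
  from R obtain \<alpha> where \<alpha>: "\<And>x. x \<in> U \<Longrightarrow> {y. agree (\<alpha> x) y x} \<subseteq> U"
    by metis
  then have "U = (\<Union>x\<in>U. {y. agree (\<alpha> x) y x})"
    by auto
  moreover have "openin (bounded_topology :: ('k \<Rightarrow> 'k) topology) (\<Union>x\<in>U. {y. agree (\<alpha> x) y x})"
    using basic by blast
  ultimately show "openin (bounded_topology :: ('k \<Rightarrow> 'k) topology) U"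
    by simp
qed

lemma topspace_bounded_topology [simp]: "topspace bounded_topology = UNIV"
proof -
  have "openin bounded_topology UNIV"
    by (simp add: openin_bounded_topology)
  then show ?thesis
    using openin_subset by blast
qed

lemma openin_cylinder: "openin bounded_topology {y. agree \<alpha> y x}"
  unfolding openin_bounded_topology using agree_trans by blast

lemma (in admissible_cardinal) le_kappa_cylinders:
  "|{{y. agree \<alpha> y s} | (\<alpha>::'k) (s::'k \<Rightarrow> 'k). True}| \<le>o kappa K"
proof (rule le_kappa_subset)
  let ?cyl = "\<lambda>p::'k \<times> ('k \<Rightarrow> 'k). {y. agree (fst p) y (snd p)}"
  let ?seq = "\<lambda>(\<alpha>::'k, s::'k \<Rightarrow> 'k). (\<alpha>, restrict s {..<\<alpha>})"
  have "{y. agree \<alpha> y s} = ?cyl (?seq (\<alpha>, s))" for \<alpha> s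
    by (auto simp: agree_def)
  then show "{{y. agree \<alpha> y s} | (\<alpha>::'k) (s::'k \<Rightarrow> 'k). True} \<subseteq> ?cyl ` range ?seq"
    by blast
  show "|?cyl ` range ?seq| \<le>o kappa K"
    by (rule le_kappa_image[OF le_kappa_sequences])
qed

text \<open>
  By \<open>\<kappa>\<^sup><\<^sup>\<kappa> = \<kappa>\<close> there are only \<open>\<kappa>\<close> many cylinders, so every open subset of \<open>\<^sup>\<kappa>\<kappa>\<close>
  is a union of at most \<open>\<kappa>\<close> of them.
\<close>

lemma (in admissible_cardinal) Bor_preimage_cylinders:
  fixes g :: "'a \<Rightarrow> 'k \<Rightarrow> 'k"
  assumes alg: "kplus_algebra K X \<B>" and g: "\<And>\<alpha> s. {x \<in> X. agree \<alpha> (g x) s} \<in> \<B>"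
    and A: "A \<in> Bor K bounded_topology"
  shows "g -` A \<inter> X \<in> \<B>"
proof (rule Bor_preimage[OF alg _ _ A])
  fix U :: "('k \<Rightarrow> 'k) set" assume U: "openin bounded_topology U"
  define I where "I = {C \<in> {{y. agree \<alpha> y s} | (\<alpha>::'k) (s::'k \<Rightarrow> 'k). True}. C \<subseteq> U}"
  have "|I| \<le>o kappa K"
    by (rule le_kappa_subset[OF _ le_kappa_cylinders]) (auto simp: I_def)
  moreover have "g -` C \<inter> X \<in> \<B>" if C: "C \<in> I" for C
  proof -
    obtain \<alpha> s where "C = {y. agree \<alpha> y s}"
      using C unfolding I_def by blast
    then have "g -` C \<inter> X = {x \<in> X. agree \<alpha> (g x) s}"
      by auto
    then show ?thesis
      using g by simp
  qed
  ultimately have "(\<Union>C\<in>I. g -` C \<inter> X) \<in> \<B>"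
    by (rule kplus_algebra_UN[OF alg])
  moreover have "g -` U \<inter> X = (\<Union>C\<in>I. g -` C \<inter> X)"
  proof -
    have "\<exists>C\<in>I. y \<in> C" if y: "y \<in> U" for y
    proof -
      obtain \<alpha> where "{z. agree \<alpha> z y} \<subseteq> U"
        using U y unfolding openin_bounded_topology by blast
      then have "{z. agree \<alpha> z y} \<in> I"
        unfolding I_def by blast
      then show ?thesis
        by (rule bexI[rotated]) simp
    qed
    then have "\<Union>I = U"
      by (auto simp: I_def)
    then show ?thesis
      by auto
  qed
  ultimately show "g -` U \<inter> X \<in> \<B>"
    by simp
qed simp

definition coordinatewise_in :: "'a set set \<Rightarrow> 'a set \<Rightarrow> ('a \<Rightarrow> 'i \<Rightarrow> 'b) \<Rightarrow> bool"
  where "coordinatewise_in \<B> X g \<longleftrightarrow> (\<forall>i v. {x \<in> X. g x i = v} \<in> \<B>)"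

lemma (in admissible_cardinal) Bor_preimage_coordinatewise:
  fixes g :: "'a \<Rightarrow> 'k \<Rightarrow> 'k"
  assumes alg: "kplus_algebra K X \<B>" and g: "coordinatewise_in \<B> X g"
    and A: "A \<in> Bor K bounded_topology"
  shows "g -` A \<inter> X \<in> \<B>"
proof (rule Bor_preimage_cylinders[OF alg _ A])
  fix \<alpha> s
  have "{x \<in> X. agree \<alpha> (g x) s} = X \<inter> (\<Inter>\<beta>\<in>{..<\<alpha>}. {x \<in> X. g x \<beta> = s \<beta>})"
    by (auto simp: agree_def)
  also have "\<dots> \<in> \<B>"
    using g by (intro kplus_algebra_INT[OF alg] le_kappa_index) (simp add: coordinatewise_in_def)
  finally show "{x \<in> X. agree \<alpha> (g x) s} \<in> \<B>" .
qed

lemma (in admissible_cardinal) coordinate_in_Bor: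
  "{y. y \<alpha> = v} \<in> Bor K (bounded_topology :: ('k \<Rightarrow> 'k) topology)"
proof (rule open_in_Bor)
  obtain \<beta> where "\<alpha> < \<beta>"
    using no_top by blast
  then have "{y. agree \<beta> y x} \<subseteq> {y. y \<alpha> = v}" if "x \<alpha> = v" for x :: "'k \<Rightarrow> 'k"
    using that by (simp add: agree_def subset_iff)
  then show "openin (bounded_topology :: ('k \<Rightarrow> 'k) topology) {y. y \<alpha> = v}"
    unfolding openin_bounded_topology by blast
qed

lemma (in admissible_cardinal) small_in_algebra:
  assumes alg: "kplus_algebra K X \<B>" and "|A| \<le>o kappa K" "\<And>x. x \<in> A \<Longrightarrow> {x} \<in> \<B>"
  shows "A \<in> \<B>"
  using kplus_algebra_UN[OF alg assms(2), of "\<lambda>x. {x}"] assms(3) by simp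

lemma (in admissible_cardinal) small_in_Bor:
  assumes "|A| \<le>o kappa K"
  shows "A \<in> Bor K (bounded_topology :: ('k \<Rightarrow> 'k) topology)"
proof (rule small_in_algebra[OF kplus_algebra_Bor assms])
  fix x :: "'k \<Rightarrow> 'k"
  have "{x} = topspace bounded_topology \<inter> (\<Inter>\<alpha>\<in>UNIV. {y. y \<alpha> = x \<alpha>})"
    by auto
  also have "\<dots> \<in> Bor K bounded_topology"
    by (intro kplus_algebra_INT[OF kplus_algebra_Bor] le_kappa_index coordinate_in_Bor)
  finally show "{x} \<in> Bor K bounded_topology" .
qed

text \<open>
  A generating family separates points as soon as the algebra does, because the sets that do not
  separate two given points form an algebra. A family of size \<open>\<kappa>\<close> that separates points
  makes singletons measurable.
\<close>

lemma (in admissible_cardinal) small_in_kBorel: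
  assumes space: "kBorel_space K X \<B>" and A: "A \<subseteq> X" "|A| \<le>o kappa K"
  shows "A \<in> \<B>"
proof -
  have alg: "kplus_algebra K X \<B>"
    and sep: "\<And>x y. x \<in> X \<Longrightarrow> y \<in> X \<Longrightarrow> x \<noteq> y \<Longrightarrow> \<exists>B\<in>\<B>. x \<in> B \<and> y \<notin> B"
    using space by (auto simp: kBorel_space_def)
  obtain \<G> where \<G>: "\<G> \<subseteq> Pow X" "|\<G>| \<le>o kappa K" "generated_kplus_algebra K X \<G> = \<B>"
    using space by (auto simp: kBorel_space_def)
  have gen: "\<G> \<subseteq> \<B>"
    unfolding \<G>(3)[symmetric] generated_kplus_algebra_def by blast
  have "{x} \<in> \<B>" if x: "x \<in> X" for x
  proof -
    have "\<exists>G\<in>\<G>. (x \<in> G) \<noteq> (y \<in> G)" if y: "y \<in> X" "y \<noteq> x" for y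
    proof (rule ccontr)
      assume "\<not> (\<exists>G\<in>\<G>. (x \<in> G) \<noteq> (y \<in> G))"
      then have "\<G> \<subseteq> {B. B \<subseteq> X \<and> (x \<in> B \<longleftrightarrow> y \<in> B)}"
        using \<G>(1) by blast
      moreover have "kplus_algebra K X {B. B \<subseteq> X \<and> (x \<in> B \<longleftrightarrow> y \<in> B)}"
        using x y(1) unfolding kplus_algebra_def by auto
      ultimately have "\<B> \<subseteq> {B. B \<subseteq> X \<and> (x \<in> B \<longleftrightarrow> y \<in> B)}"
        unfolding \<G>(3)[symmetric] generated_kplus_algebra_def by (intro Inter_lower) simp
      then show False
        using sep[OF x y(1)] y(2) by blast
    qed
    then have "{x} = X \<inter> (\<Inter>G\<in>\<G>. if x \<in> G then G else X - G)"
      using x by (auto split: if_splits)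
    also have "\<dots> \<in> \<B>"
      using gen by (intro kplus_algebra_INT[OF alg \<G>(2)]) (auto intro: kplus_algebra_compl[OF alg])
    finally show ?thesis .
  qed
  then show ?thesis
    using A by (intro small_in_algebra[OF alg A(2)]) blast
qed

section \<open>From a winning strategy to a Borel subset of \<open>\<^sup>\<kappa>\<kappa>\<close>\<close>

text \<open>
  The enumeration \<open>e\<close> of pairs schedules tasks: round \<open>\<alpha>\<close> of each run treats the pair of
  basic sets with indices \<open>e \<alpha>\<close>.
\<close>

locale fair_game = admissible_cardinal K for K :: "'k::wellorder itself" +
  fixes \<tau> :: "'a topology" and \<sigma> :: "('k, 'a) strategy"
    and B :: "'k \<Rightarrow> 'a set" and e :: "'k \<Rightarrow> 'k \<times> 'k"
  assumes winning: "winning_fair \<tau> \<sigma>"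
    and regular: "regular_space \<tau>" and Hausdorff: "Hausdorff_space \<tau>"
    and basis_open: "\<And>i. openin \<tau> (B i)"
    and basis: "\<And>U x. openin \<tau> U \<Longrightarrow> x \<in> U \<Longrightarrow> \<exists>i. x \<in> B i \<and> B i \<subseteq> U"
    and pairs: "surj e"
begin

text \<open>
  Since II follows a strategy, a run is determined by the moves \<open>m\<close> of I.
\<close>

definition response :: "('k \<Rightarrow> 'a set \<times> 'a) \<Rightarrow> 'k \<Rightarrow> 'a set"
  where "response m \<alpha> = \<sigma> \<alpha> (restrict m {..\<alpha>})"

text \<open>
  When the closure of \<open>B j\<close> lies in \<open>B i\<close>, a set that decides the pair \<open>(i, j)\<close> cannot meet \<open>B j\<close>
  without being contained in \<open>B i\<close>. The proviso ensures that every point has an open neighbourhood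
  that decides the pair: \<open>B i\<close> or the complement of the closure of \<open>B j\<close>.
\<close>

definition decides :: "'k \<Rightarrow> 'a set \<Rightarrow> bool"
  where "decides \<alpha> U \<longleftrightarrow>
    (\<tau> closure_of B (snd (e \<alpha>)) \<subseteq> B (fst (e \<alpha>)) \<longrightarrow>
      U \<subseteq> B (fst (e \<alpha>)) \<or> U \<inter> B (snd (e \<alpha>)) = {})"

text \<open>
  Here \<open>m\<close> stands for a run of length \<open>\<alpha>\<close>, given by its values below \<open>\<alpha>\<close>, and \<open>F\<close> lists \<open>\<kappa>\<close> many
  continuations by one move of I.
\<close>

definition good_family :: "'k \<Rightarrow> ('k \<Rightarrow> 'a set \<times> 'a) \<Rightarrow> ('k \<Rightarrow> 'a set \<times> 'a) \<Rightarrow> bool"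
  where "good_family \<alpha> m F \<longleftrightarrow>
    (\<forall>i. legal_I \<tau> (m(\<alpha> := F i)) (response m) \<alpha> \<and> decides \<alpha> (fst (F i))) \<and>
    meet \<tau> (response m) {..<\<alpha>} \<subseteq> (\<Union>i. response (m(\<alpha> := F i)) \<alpha>)"

lemma response_cong: "(\<And>\<beta>. \<beta> \<le> \<alpha> \<Longrightarrow> m \<beta> = m' \<beta>) \<Longrightarrow> response m \<alpha> = response m' \<alpha>"
  unfolding response_def by (metis atMost_iff restrict_ext)

lemma meet_cong: "(\<And>\<beta>. \<beta> \<in> D \<Longrightarrow> V \<beta> = V' \<beta>) \<Longrightarrow> meet \<tau> V D = meet \<tau> V' D"
  by (auto simp: meet_def)

lemma meet_response_cong:
  "(\<And>\<beta>. \<beta> < \<alpha> \<Longrightarrow> m \<beta> = m' \<beta>) \<Longrightarrow> meet \<tau> (response m) {..<\<alpha>} = meet \<tau> (response m') {..<\<alpha>}"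
  by (intro meet_cong response_cong) auto

lemma legal_I_cong:
  "(\<And>\<beta>. \<beta> \<le> \<alpha> \<Longrightarrow> m \<beta> = m' \<beta>) \<Longrightarrow>
    legal_I \<tau> m (response m) \<alpha> = legal_I \<tau> m' (response m') \<alpha>"
  using meet_response_cong[of \<alpha> m m'] by (simp add: legal_I_def)

lemma meet_response_update [simp]: "meet \<tau> (response (m(\<alpha> := p))) {..<\<alpha>} = meet \<tau> (response m) {..<\<alpha>}"
  by (intro meet_response_cong) auto

lemma legal_I_update [simp]:
  "legal_I \<tau> (m(\<alpha> := p)) (response (m(\<alpha> := p))) \<alpha> = legal_I \<tau> (m(\<alpha> := p)) (response m) \<alpha>"
  by (simp add: legal_I_def)

lemma legal_I_update_later [simp]:
  "\<beta> < \<alpha> \<Longrightarrow> legal_I \<tau> (m(\<alpha> := p)) (response (m(\<alpha> := p))) \<beta> = legal_I \<tau> m (response m) \<beta>"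
  by (intro legal_I_cong) auto

lemma run_by_response: "run_by \<tau> \<sigma> m (response m) D \<longleftrightarrow> (\<forall>\<alpha>\<in>D. legal_I \<tau> m (response m) \<alpha>)"
  by (simp add: run_by_def response_def)

lemma legal_II_response: "run_by \<tau> \<sigma> m (response m) {..\<alpha>} \<Longrightarrow> legal_II \<tau> m (response m) \<alpha>"
  using winning by (simp add: winning_fair_def legal_strategy_def)

lemma deciding_neighbourhood:
  assumes x: "x \<in> P" and P: "P \<subseteq> topspace \<tau>"
  shows "\<exists>U. openin (subtopology \<tau> P) U \<and> x \<in> U \<and> decides \<alpha> U"
proof -
  obtain i j where e: "e \<alpha> = (i, j)"
    by fastforce
  consider "x \<in> B i" | "x \<notin> B i" "\<tau> closure_of B j \<subseteq> B i" | "\<not> \<tau> closure_of B j \<subseteq> B i"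
    by blast
  then show ?thesis
  proof cases
    case 1
    then show ?thesis
      using x basis_open[of i] by (intro exI[of _ "P \<inter> B i"]) (auto simp: e decides_def openin_subtopology_Int2)
  next
    case 2
    have "openin \<tau> (topspace \<tau> - \<tau> closure_of B j)"
      by (intro openin_diff openin_topspace closedin_closure_of)
    moreover have "B j \<subseteq> \<tau> closure_of B j"
      using basis_open[of j] by (intro closure_of_subset openin_subset)
    ultimately show ?thesis
      using x P 2
      by (intro exI[of _ "P \<inter> (topspace \<tau> - \<tau> closure_of B j)"])
        (auto simp: e decides_def openin_subtopology_Int2)
  next
    case 3
    then show ?thesis
      using x P by (intro exI[of _ P]) (auto simp: e decides_def openin_subtopology_refl)
  qed
qed

text \<open>
  For each point \<open>x\<close> of the position I may play a deciding neighbourhood \<open>U x\<close> of \<open>x\<close>. The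
  answers of II cover the position, and since the weight is at most \<open>\<kappa>\<close>, already \<open>\<kappa>\<close> many of them
  do: it suffices to keep one point for each basic set that is used to refine the answers.
\<close>

lemma good_family_exists:
  assumes run: "run_by \<tau> \<sigma> m (response m) {..<\<alpha>}" and ne: "meet \<tau> (response m) {..<\<alpha>} \<noteq> {}"
  shows "\<exists>F. good_family \<alpha> m F"
proof -
  define P where "P = meet \<tau> (response m) {..<\<alpha>}"
  have P: "P \<subseteq> topspace \<tau>"
    by (auto simp: P_def meet_def)
  obtain x\<^sub>0 where x\<^sub>0: "x\<^sub>0 \<in> P"
    using ne by (auto simp: P_def)
  have "\<forall>x\<in>P. \<exists>U. openin (subtopology \<tau> P) U \<and> x \<in> U \<and> decides \<alpha> U"
    using deciding_neighbourhood[OF _ P] by blast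
  from bchoice[OF this] obtain U
    where U: "\<And>x. x \<in> P \<Longrightarrow> openin (subtopology \<tau> P) (U x) \<and> x \<in> U x \<and> decides \<alpha> (U x)"
    by blast
  define R where "R x = response (m(\<alpha> := (U x, x))) \<alpha>" for x
  have legal: "legal_I \<tau> (m(\<alpha> := (U x, x))) (response m) \<alpha>" if "x \<in> P" for x
    using U[OF that] by (simp add: legal_I_def P_def)
  have R: "openin (subtopology \<tau> P) (R x) \<and> x \<in> R x" if x: "x \<in> P" for x
  proof -
    let ?m = "m(\<alpha> := (U x, x))"
    have "legal_I \<tau> ?m (response ?m) \<beta>" if "\<beta> < \<alpha>" for \<beta>
      using that run by (simp add: run_by_response)
    then have "legal_II \<tau> ?m (response ?m) \<alpha>"
      using legal[OF x] by (intro legal_II_response) (auto simp: run_by_response order.order_iff_strict)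
    then show ?thesis
      by (simp add: legal_II_def R_def P_def)
  qed
  have "\<exists>i. x \<in> B i \<and> B i \<inter> P \<subseteq> R x" if x: "x \<in> P" for x
  proof -
    obtain O' where "openin \<tau> O'" "R x = O' \<inter> P"
      using R[OF x] by (auto simp: openin_subtopology)
    then show ?thesis
      using R[OF x] basis[of O' x] by blast
  qed
  then obtain c where c: "\<And>x. x \<in> P \<Longrightarrow> x \<in> B (c x) \<and> B (c x) \<inter> P \<subseteq> R x"
    by metis
  have "\<exists>y. y \<in> P \<and> (\<forall>x\<in>P. c x = i \<longrightarrow> c y = i)" for i
    using x\<^sub>0 by blast
  then obtain pt where pt: "\<And>i. pt i \<in> P" "\<And>i x. x \<in> P \<Longrightarrow> c x = i \<Longrightarrow> c (pt i) = i"
    by metis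
  have "P \<subseteq> (\<Union>i. R (pt i))"
  proof
    fix x assume x: "x \<in> P"
    then have "x \<in> R (pt (c x))"
      using c[OF x] c[OF pt(1)[of "c x"]] pt(2)[OF x refl] by auto
    then show "x \<in> (\<Union>i. R (pt i))"
      by blast
  qed
  then have "good_family \<alpha> m (\<lambda>i. (U (pt i), pt i))"
    using legal[OF pt(1)] U[OF pt(1)] by (simp add: good_family_def P_def R_def)
  then show ?thesis
    by blast
qed

definition family :: "'k \<Rightarrow> ('k \<Rightarrow> 'a set \<times> 'a) \<Rightarrow> 'k \<Rightarrow> 'a set \<times> 'a"
  where "family \<alpha> m = (SOME F. good_family \<alpha> m F)"

text \<open>
  The run selected by \<open>y\<close>: in round \<open>\<alpha>\<close>, I plays the member with index \<open>y \<alpha>\<close> of a good family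
  for the run so far.
\<close>

definition moves :: "('k \<Rightarrow> 'k) \<Rightarrow> 'k \<Rightarrow> 'a set \<times> 'a"
  where "moves y = wfrec {(\<beta>, \<alpha>). \<beta> < \<alpha>} (\<lambda>m \<alpha>. family \<alpha> m (y \<alpha>))"

abbreviation past :: "('k \<Rightarrow> 'k) \<Rightarrow> 'k \<Rightarrow> 'k \<Rightarrow> 'a set \<times> 'a"
  where "past y \<alpha> \<equiv> cut (moves y) {(\<beta>, \<alpha>). \<beta> < \<alpha>} \<alpha>"

lemma moves_rec: "moves y \<alpha> = family \<alpha> (past y \<alpha>) (y \<alpha>)"
  using def_wfrec[OF moves_def[THEN eq_reflection] wf] by simp

lemma moves_cong: "(\<And>\<beta>. \<beta> \<le> \<alpha> \<Longrightarrow> y \<beta> = z \<beta>) \<Longrightarrow> moves y \<alpha> = moves z \<alpha>"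
proof (induction \<alpha> rule: less_induct)
  case (less \<alpha>)
  have "moves y \<beta> = moves z \<beta>" if "\<beta> < \<alpha>" for \<beta>
    using that less.prems by (intro less.IH) auto
  then have "past y \<alpha> = past z \<alpha>"
    by (simp add: cuts_eq)
  then show ?case
    using less.prems[of \<alpha>] by (simp add: moves_rec)
qed

lemma past_eq: "\<beta> < \<alpha> \<Longrightarrow> past y \<alpha> \<beta> = moves y \<beta>"
  by (simp add: cut_apply)

lemma good_family_cong:
  assumes "\<And>\<beta>. \<beta> < \<alpha> \<Longrightarrow> m \<beta> = m' \<beta>"
  shows "good_family \<alpha> m F = good_family \<alpha> m' F"
proof -
  have "legal_I \<tau> (m(\<alpha> := F i)) (response m) \<alpha> = legal_I \<tau> (m'(\<alpha> := F i)) (response m') \<alpha>" for i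
    using meet_response_cong[OF assms] by (simp add: legal_I_def)
  moreover have "response (m(\<alpha> := F i)) \<alpha> = response (m'(\<alpha> := F i)) \<alpha>" for i
    using assms by (intro response_cong) auto
  ultimately show ?thesis
    using meet_response_cong[OF assms] by (simp add: good_family_def)
qed

text \<open>
  The answers of II along \<open>y\<close>, and the position \<open>P y \<alpha>\<close> that they leave before round \<open>\<alpha>\<close>.
\<close>

definition V :: "('k \<Rightarrow> 'k) \<Rightarrow> 'k \<Rightarrow> 'a set"
  where "V y = response (moves y)"

abbreviation P :: "('k \<Rightarrow> 'k) \<Rightarrow> 'k \<Rightarrow> 'a set"
  where "P y \<alpha> \<equiv> meet \<tau> (V y) {..<\<alpha>}"

lemma V_cong: "(\<And>\<beta>. \<beta> \<le> \<alpha> \<Longrightarrow> y \<beta> = z \<beta>) \<Longrightarrow> V y \<alpha> = V z \<alpha>"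
  unfolding V_def by (intro response_cong moves_cong) auto

lemma P_cong: "agree \<alpha> y z \<Longrightarrow> P y \<alpha> = P z \<alpha>"
  by (intro meet_cong V_cong) (auto simp: agree_def)

lemma P_antimono: "\<beta> \<le> \<alpha> \<Longrightarrow> P y \<alpha> \<subseteq> P y \<beta>"
  by (auto simp: meet_def)

lemma P_subset_V: "\<beta> < \<alpha> \<Longrightarrow> P y \<alpha> \<subseteq> V y \<beta>"
  by (auto simp: meet_def)

text \<open>
  A nonempty position in round \<open>\<alpha>\<close> makes all earlier ones nonempty, so that good families existed
  and I moved legally up to \<open>\<alpha>\<close>.
\<close>

lemma scheme_good:
  assumes "P y \<alpha> \<noteq> {}"
  shows "run_by \<tau> \<sigma> (moves y) (V y) {..<\<alpha>} \<and> good_family \<alpha> (moves y) (family \<alpha> (past y \<alpha>))"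
  using assms
proof (induction \<alpha> rule: less_induct)
  case (less \<alpha>)
  have run: "run_by \<tau> \<sigma> (moves y) (V y) {..<\<alpha>}"
    unfolding V_def run_by_response
  proof
    fix \<beta> assume "\<beta> \<in> {..<\<alpha>}"
    then have "P y \<beta> \<noteq> {}"
      using less.prems P_antimono[of \<beta> \<alpha> y] by auto
    then have "good_family \<beta> (moves y) (family \<beta> (past y \<beta>))"
      using less.IH \<open>\<beta> \<in> {..<\<alpha>}\<close> by simp
    then have "legal_I \<tau> ((moves y)(\<beta> := moves y \<beta>)) (response (moves y)) \<beta>"
      unfolding good_family_def moves_rec[of y \<beta>] by blast
    then show "legal_I \<tau> (moves y) (response (moves y)) \<beta>"
      by simp
  qed
  obtain F where "good_family \<alpha> (moves y) F"
    using good_family_exists run less.prems unfolding V_def by blast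
  then have "good_family \<alpha> (past y \<alpha>) F"
    using good_family_cong[of \<alpha> "past y \<alpha>" "moves y"] past_eq by blast
  then have "good_family \<alpha> (past y \<alpha>) (family \<alpha> (past y \<alpha>))"
    unfolding family_def by (rule someI[where P = "good_family \<alpha> (past y \<alpha>)"])
  then show ?case
    using run good_family_cong[of \<alpha> "past y \<alpha>" "moves y"] past_eq by blast
qed

lemma scheme_legal:
  assumes "P y \<alpha> \<noteq> {}"
  shows "openin (subtopology \<tau> (P y \<alpha>)) (V y \<alpha>)" and "decides \<alpha> (V y \<alpha>)"
proof -
  have good: "good_family \<alpha> (moves y) (family \<alpha> (past y \<alpha>))"
    and run: "run_by \<tau> \<sigma> (moves y) (V y) {..<\<alpha>}"
    using scheme_good[OF assms] by auto
  have "legal_I \<tau> ((moves y)(\<alpha> := moves y \<alpha>)) (response (moves y)) \<alpha>"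
    and dec: "decides \<alpha> (fst (moves y \<alpha>))"
    using good unfolding good_family_def moves_rec[of y \<alpha>] by blast+
  then have "run_by \<tau> \<sigma> (moves y) (response (moves y)) {..\<alpha>}"
    using run by (auto simp: run_by_response V_def order.order_iff_strict)
  from legal_II_response[OF this] show "openin (subtopology \<tau> (P y \<alpha>)) (V y \<alpha>)" "decides \<alpha> (V y \<alpha>)"
    using dec by (auto simp: legal_II_def V_def decides_def)
qed

lemma scheme_cover:
  assumes "x \<in> P y \<alpha>"
  shows "\<exists>i. x \<in> V (y(\<alpha> := i)) \<alpha>"
proof -
  have "good_family \<alpha> (moves y) (family \<alpha> (past y \<alpha>))"
    using scheme_good assms by blast
  then obtain i where i: "x \<in> response ((moves y)(\<alpha> := family \<alpha> (past y \<alpha>) i)) \<alpha>"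
    using assms unfolding good_family_def V_def by blast
  have past: "moves (y(\<alpha> := i)) \<beta> = moves y \<beta>" if "\<beta> < \<alpha>" for \<beta>
    using that by (intro moves_cong) auto
  then have "past (y(\<alpha> := i)) \<alpha> = past y \<alpha>"
    by (simp add: cuts_eq)
  then have "moves (y(\<alpha> := i)) \<alpha> = family \<alpha> (past y \<alpha>) i"
    by (simp add: moves_rec)
  then have "V (y(\<alpha> := i)) \<alpha> = response ((moves y)(\<alpha> := family \<alpha> (past y \<alpha>) i)) \<alpha>"
    unfolding V_def using past by (intro response_cong) auto
  then show ?thesis
    using i by blast
qed

text \<open>
  If no position along \<open>y\<close> is empty, the run has full length, and this is the case in which the fair
  game grants a point in the intersection.
\<close>

lemma scheme_win:
  assumes "\<And>\<alpha>. P y \<alpha> \<noteq> {}"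
  shows "meet \<tau> (V y) UNIV \<noteq> {}"
proof -
  have "run_by \<tau> \<sigma> (moves y) (V y) {..<\<alpha>}" for \<alpha>
    using scheme_good[OF assms] by blast
  then have "run_by \<tau> \<sigma> (moves y) (V y) UNIV"
    unfolding run_by_def using no_top by blast
  then show ?thesis
    using winning by (simp add: winning_fair_def)
qed

text \<open>
  The answers of II overlap. Taking the least index selects a unique branch for each point, in a
  Borel way.
\<close>

definition address :: "'a \<Rightarrow> 'k \<Rightarrow> 'k"
  where "address x = wfrec {(\<beta>, \<alpha>). \<beta> < \<alpha>} (\<lambda>b \<alpha>. LEAST i. x \<in> V (b(\<alpha> := i)) \<alpha>)"

lemma address_rec: "address x \<alpha> = (LEAST i. x \<in> V ((address x)(\<alpha> := i)) \<alpha>)"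
proof -
  have "V ((cut (address x) {(\<beta>, \<alpha>). \<beta> < \<alpha>} \<alpha>)(\<alpha> := i)) \<alpha> = V ((address x)(\<alpha> := i)) \<alpha>" for i
    by (intro V_cong) (auto simp: cut_apply)
  then show ?thesis
    using def_wfrec[OF address_def[THEN eq_reflection] wf] by simp
qed

lemma address_in_V:
  assumes "x \<in> topspace \<tau>"
  shows "x \<in> V (address x) \<alpha>"
proof (induction \<alpha> rule: less_induct)
  case (less \<alpha>)
  then have "x \<in> P (address x) \<alpha>"
    using assms by (auto simp: meet_def)
  then have "\<exists>i. x \<in> V ((address x)(\<alpha> := i)) \<alpha>"
    by (rule scheme_cover)
  then have "x \<in> V ((address x)(\<alpha> := LEAST i. x \<in> V ((address x)(\<alpha> := i)) \<alpha>)) \<alpha>"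
    by (rule LeastI_ex)
  then show ?case
    by (simp only: address_rec[of x \<alpha>, symmetric] fun_upd_triv)
qed

definition live :: "('k \<Rightarrow> 'k) set"
  where "live = {y. \<forall>\<alpha>. P y \<alpha> \<noteq> {}}"

definition point :: "('k \<Rightarrow> 'k) \<Rightarrow> 'a"
  where "point y = (SOME x. x \<in> meet \<tau> (V y) UNIV)"

lemma point_in_P: "y \<in> live \<Longrightarrow> point y \<in> P y \<alpha>"
  using scheme_win[of y] someI_ex[of "\<lambda>x. x \<in> meet \<tau> (V y) UNIV"]
  unfolding live_def point_def meet_def by blast

text \<open>
  If \<open>x \<in> B i\<close>, then by regularity \<open>x \<in> B j\<close> for some \<open>j\<close> whose closure is contained in \<open>B i\<close>.
  The answer of II in the round that treats \<open>(i, j)\<close> meets \<open>B j\<close>, hence lies in \<open>B i\<close>. So the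
  positions along a branch form a neighbourhood base at each point in their intersection.
\<close>

lemma positions_shrink:
  assumes x: "\<And>\<alpha>. x \<in> P y \<alpha>"
  shows "x \<in> B i \<longleftrightarrow> (\<exists>\<alpha>. P y \<alpha> \<subseteq> B i)"
proof
  assume "x \<in> B i"
  moreover have "neighbourhood_base_of (closedin \<tau>) \<tau>"
    using regular by (simp add: neighbourhood_base_of_closedin)
  ultimately obtain U C where U: "openin \<tau> U" "closedin \<tau> C" "x \<in> U" "U \<subseteq> C" "C \<subseteq> B i"
    using basis_open[of i] unfolding neighbourhood_base_of by metis
  then obtain j where j: "x \<in> B j" "B j \<subseteq> U"
    using basis by blast
  obtain \<alpha> where \<alpha>: "e \<alpha> = (i, j)"
    using pairs by (metis surj_def)
  obtain \<gamma> where \<gamma>: "\<alpha> < \<gamma>"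
    using no_top by blast
  have "\<tau> closure_of B j \<subseteq> B i"
    using U j closure_of_minimal[of "B j" C \<tau>] by blast
  moreover have "x \<in> V y \<alpha>"
    using x P_subset_V[OF \<gamma>] by blast
  moreover have "decides \<alpha> (V y \<alpha>)"
    using scheme_legal(2) x by blast
  ultimately have "V y \<alpha> \<subseteq> B i"
    using j(1) by (auto simp: decides_def \<alpha>)
  then show "\<exists>\<alpha>. P y \<alpha> \<subseteq> B i"
    using P_subset_V[OF \<gamma>] by blast
qed (use x in blast)

lemma point_unique:
  assumes y: "y \<in> live" and x: "\<And>\<alpha>. x \<in> P y \<alpha>"
  shows "point y = x"
proof (rule ccontr)
  assume "point y \<noteq> x"
  moreover have "point y \<in> topspace \<tau>" "x \<in> topspace \<tau>"
    using point_in_P[OF y] x by (auto simp: meet_def)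
  ultimately obtain U where "openin \<tau> U" "x \<in> U" "point y \<notin> U"
    using Hausdorff unfolding Hausdorff_space_def disjnt_iff by metis
  then obtain i where "x \<in> B i" "point y \<notin> B i"
    using basis by blast
  then show False
    using positions_shrink[OF x] point_in_P[OF y] by blast
qed

lemma address_in_P: "x \<in> topspace \<tau> \<Longrightarrow> x \<in> P (address x) \<alpha>"
  using address_in_V by (auto simp: meet_def)

lemma address_live: "x \<in> topspace \<tau> \<Longrightarrow> address x \<in> live"
  using address_in_P unfolding live_def by blast

lemma point_address: "x \<in> topspace \<tau> \<Longrightarrow> point (address x) = x"
  using address_live address_in_P by (intro point_unique)

lemma live_in_Bor: "live \<in> Bor K bounded_topology"
proof -
  have "openin bounded_topology {y. P y \<alpha> \<noteq> {}}" for \<alpha>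
    unfolding openin_bounded_topology
  proof
    fix y assume "y \<in> {y. P y \<alpha> \<noteq> {}}"
    then have "{z. agree \<alpha> z y} \<subseteq> {y. P y \<alpha> \<noteq> {}}"
      using P_cong[of \<alpha>] by auto
    then show "\<exists>\<beta>. {z. agree \<beta> z y} \<subseteq> {y. P y \<alpha> \<noteq> {}}" ..
  qed
  then have "topspace bounded_topology \<inter> (\<Inter>\<alpha>. {y. P y \<alpha> \<noteq> {}}) \<in> Bor K bounded_topology"
    by (intro kplus_algebra_INT[OF kplus_algebra_Bor le_kappa_index] open_in_Bor)
  moreover have "live = topspace bounded_topology \<inter> (\<Inter>\<alpha>. {y. P y \<alpha> \<noteq> {}})"
    by (auto simp: live_def)
  ultimately show ?thesis
    by simp
qed

text \<open>
  Whether the point of \<open>y\<close> lies in an open set is decided by the inclusion of some position in a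
  basic set, and a position depends on an initial segment of \<open>y\<close> only.
\<close>

lemma point_measurable:
  assumes "A \<in> Bor K \<tau>"
  shows "{y \<in> live. point y \<in> A} \<in> Bor K bounded_topology"
proof -
  have "point -` A \<inter> live \<in> {A \<in> Bor K bounded_topology. A \<subseteq> live}"
  proof (rule Bor_preimage[OF _ _ _ assms])
    show "kplus_algebra K live {A \<in> Bor K bounded_topology. A \<subseteq> live}"
      by (rule kplus_algebra_below[OF kplus_algebra_Bor live_in_Bor])
    show "point y \<in> topspace \<tau>" if "y \<in> live" for y
      using point_in_P[OF that] by (auto simp: meet_def)
    fix U assume U: "openin \<tau> U"
    define W where "W = {y. \<exists>\<alpha> i. P y \<alpha> \<subseteq> B i \<and> B i \<subseteq> U}"
    have "openin bounded_topology W"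
      unfolding openin_bounded_topology
    proof
      fix y assume "y \<in> W"
      then obtain \<alpha> i where "P y \<alpha> \<subseteq> B i" "B i \<subseteq> U"
        by (auto simp: W_def)
      then have "{z. agree \<alpha> z y} \<subseteq> W"
        using P_cong unfolding W_def by blast
      then show "\<exists>\<alpha>. {z. agree \<alpha> z y} \<subseteq> W" ..
    qed
    moreover have "point -` U \<inter> live = W \<inter> live"
    proof -
      have "point y \<in> U \<longleftrightarrow> y \<in> W" if y: "y \<in> live" for y
      proof
        assume "point y \<in> U"
        then obtain i where "point y \<in> B i" "B i \<subseteq> U"
          using basis[OF U] by blast
        then show "y \<in> W"
          using positions_shrink[OF point_in_P[OF y]] by (auto simp: W_def)
      qed (use point_in_P[OF y] in \<open>auto simp: W_def\<close>)
      then show ?thesis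
        by auto
    qed
    ultimately show "point -` U \<inter> live \<in> {A \<in> Bor K bounded_topology. A \<subseteq> live}"
      using kplus_algebra_Int[OF kplus_algebra_Bor open_in_Bor live_in_Bor] by auto
  qed
  moreover have "point -` A \<inter> live = {y \<in> live. point y \<in> A}"
    by auto
  ultimately show ?thesis
    by simp
qed

text \<open>
  By induction: a position is an intersection of fewer than \<open>\<kappa>\<close> answers, and an answer is the
  trace of an open set on a position.
\<close>

lemma P_and_V_in_Bor:
  assumes "P y \<alpha> \<noteq> {}"
  shows "P y \<alpha> \<in> Bor K \<tau>" and "V y \<alpha> \<in> Bor K \<tau>"
proof -
  have "P y \<alpha> \<in> Bor K \<tau> \<and> V y \<alpha> \<in> Bor K \<tau>"
    using assms
  proof (induction \<alpha> rule: less_induct)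
    case (less \<alpha>)
    have "V y \<beta> \<in> Bor K \<tau>" if "\<beta> < \<alpha>" for \<beta>
      using less.IH[OF that] less.prems P_antimono[OF less_imp_le[OF that], of y] by blast
    then have P: "P y \<alpha> \<in> Bor K \<tau>"
      unfolding meet_def by (intro kplus_algebra_INT[OF kplus_algebra_Bor le_kappa_index]) auto
    obtain U where "openin \<tau> U" "V y \<alpha> = U \<inter> P y \<alpha>"
      using scheme_legal(1)[OF less.prems] by (auto simp: openin_subtopology)
    then show ?case
      using P kplus_algebra_Int[OF kplus_algebra_Bor open_in_Bor P] by auto
  qed
  then show "P y \<alpha> \<in> Bor K \<tau>" "V y \<alpha> \<in> Bor K \<tau>"
    by auto
qed

text \<open>
  Among the points whose address begins with \<open>s\<close> restricted to \<open>\<beta>\<close>, the next digit is \<open>s \<beta>\<close>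
  iff the answer with index \<open>s \<beta>\<close> contains the point and no answer with smaller index does.
\<close>

lemma address_cylinder_in_Bor: "{x \<in> topspace \<tau>. agree \<alpha> (address x) s} \<in> Bor K \<tau>"
proof (induction \<alpha> rule: less_induct)
  case (less \<alpha>)
  define W where "W \<beta> = {x \<in> topspace \<tau>. agree \<beta> (address x) s}" for \<beta>
  have step: "W \<beta> \<inter> {x. address x \<beta> = s \<beta>} \<in> Bor K \<tau>" if \<beta>: "\<beta> < \<alpha>" for \<beta>
  proof (cases "W \<beta> = {}")
    case True
    then show ?thesis
      using kplus_algebra_empty[OF kplus_algebra_Bor] by simp
  next
    case False
    have "W \<beta> \<subseteq> P s \<beta>"
      unfolding W_def using address_in_P P_cong by blast
    then have ne: "P (s(\<beta> := i)) \<beta> \<noteq> {}" for i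
      using False P_cong[of \<beta> s "s(\<beta> := i)"] by (auto simp: agree_def)
    have "address x \<beta> = s \<beta> \<longleftrightarrow> x \<in> V s \<beta> - (\<Union>i\<in>{..<s \<beta>}. V (s(\<beta> := i)) \<beta>)" if x: "x \<in> W \<beta>" for x
    proof -
      have eq: "V ((address x)(\<beta> := i)) \<beta> = V (s(\<beta> := i)) \<beta>" for i
        using x by (intro V_cong) (auto simp: W_def agree_def order.order_iff_strict)
      have ad: "address x \<beta> = (LEAST i. x \<in> V (s(\<beta> := i)) \<beta>)"
        unfolding address_rec[of x \<beta>] eq ..
      show ?thesis
      proof
        assume a: "address x \<beta> = s \<beta>"
        have "x \<in> V ((address x)(\<beta> := s \<beta>)) \<beta>"
          using address_in_V[of x \<beta>] x a by (metis (no_types, lifting) W_def fun_upd_triv mem_Collect_eq)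
        then have "x \<in> V s \<beta>"
          unfolding eq by simp
        moreover have "x \<notin> V (s(\<beta> := i)) \<beta>" if "i < s \<beta>" for i
          using that not_less_Least[of i "\<lambda>i. x \<in> V (s(\<beta> := i)) \<beta>"] ad a by simp
        ultimately show "x \<in> V s \<beta> - (\<Union>i\<in>{..<s \<beta>}. V (s(\<beta> := i)) \<beta>)"
          by blast
      next
        assume x: "x \<in> V s \<beta> - (\<Union>i\<in>{..<s \<beta>}. V (s(\<beta> := i)) \<beta>)"
        show "address x \<beta> = s \<beta>"
          unfolding ad
        proof (rule Least_equality)
          show "x \<in> V (s(\<beta> := s \<beta>)) \<beta>"
            using x by simp
          show "s \<beta> \<le> i" if "x \<in> V (s(\<beta> := i)) \<beta>" for i
            using x that by (meson DiffE UN_I lessThan_iff not_le)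
        qed
      qed
    qed
    then have "W \<beta> \<inter> {x. address x \<beta> = s \<beta>} = W \<beta> \<inter> (V s \<beta> - (\<Union>i\<in>{..<s \<beta>}. V (s(\<beta> := i)) \<beta>))"
      by blast
    also have "\<dots> \<in> Bor K \<tau>"
    proof (intro kplus_algebra_Int[OF kplus_algebra_Bor] kplus_algebra_Diff[OF kplus_algebra_Bor]
        kplus_algebra_UN[OF kplus_algebra_Bor le_kappa_index])
      show "W \<beta> \<in> Bor K \<tau>"
        using less.IH[OF \<beta>] by (simp add: W_def)
      show "V s \<beta> \<in> Bor K \<tau>"
        using P_and_V_in_Bor(2)[OF ne[of "s \<beta>"]] by simp
      show "V (s(\<beta> := i)) \<beta> \<in> Bor K \<tau>" for i
        by (rule P_and_V_in_Bor(2)[OF ne])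
    qed
    finally show ?thesis .
  qed
  have "{x \<in> topspace \<tau>. agree \<alpha> (address x) s} =
      topspace \<tau> \<inter> (\<Inter>\<beta>\<in>{..<\<alpha>}. W \<beta> \<inter> {x. address x \<beta> = s \<beta>})"
    by (auto simp: W_def agree_def)
  also have "\<dots> \<in> Bor K \<tau>"
    using step by (intro kplus_algebra_INT[OF kplus_algebra_Bor le_kappa_index]) auto
  finally show ?case .
qed

lemma address_measurable: "A \<in> Bor K bounded_topology \<Longrightarrow> address -` A \<inter> topspace \<tau> \<in> Bor K \<tau>"
  by (rule Bor_preimage_cylinders[OF kplus_algebra_Bor address_cylinder_in_Bor])

text \<open>
  The range of a Borel map need not be Borel. Here the map has the left inverse \<open>point\<close>, which is Borel
  on a Borel set, so the range is the set of fixed points of a Borel map.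
\<close>

lemma range_address_in_Bor: "address ` topspace \<tau> \<in> Bor K bounded_topology"
proof -
  have top: "point y \<in> topspace \<tau>" if "y \<in> live" for y
    using point_in_P[OF that] by (auto simp: meet_def)
  have "address ` topspace \<tau> = {y \<in> live. address (point y) = y}"
    using point_address address_live top by force
  also have "\<dots> = live - (\<Union>(\<alpha>, v)\<in>UNIV. {y \<in> live. point y \<in> {x \<in> topspace \<tau>. address x \<alpha> = v}} - {y. y \<alpha> = v})"
    using top by (auto simp: fun_eq_iff)
  also have "\<dots> \<in> Bor K bounded_topology"
  proof (intro kplus_algebra_Diff[OF kplus_algebra_Bor live_in_Bor] kplus_algebra_UN[OF kplus_algebra_Bor])
    show "|UNIV :: ('k \<times> 'k) set| \<le>o kappa K"
      using le_kappa_Times[OF le_kappa_index le_kappa_index, of UNIV UNIV] by simp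
    fix p :: "'k \<times> 'k"
    obtain \<alpha> v where p: "p = (\<alpha>, v)"
      by fastforce
    have "address -` {y. y \<alpha> = v} \<inter> topspace \<tau> \<in> Bor K \<tau>"
      by (rule address_measurable[OF coordinate_in_Bor])
    then have "{x \<in> topspace \<tau>. address x \<alpha> = v} \<in> Bor K \<tau>"
      by (simp add: vimage_def Collect_conj_eq Int_commute)
    then show "(case p of (\<alpha>, v) \<Rightarrow> {y \<in> live. point y \<in> {x \<in> topspace \<tau>. address x \<alpha> = v}} - {y. y \<alpha> = v})
        \<in> Bor K bounded_topology"
      unfolding p prod.case
      by (intro kplus_algebra_Diff[OF kplus_algebra_Bor] point_measurable coordinate_in_Bor)
  qed
  finally show ?thesis .
qed

lemma standard: "standard_kBorel K (topspace \<tau>) (Bor K \<tau>)"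
  unfolding standard_kBorel_def kBorel_isomorphism_def
proof (intro bexI[OF _ range_address_in_Bor] exI[of _ address] conjI ballI)
  let ?X = "topspace \<tau>"
  show "bij_betw address ?X (address ` ?X)"
    by (intro inj_on_imp_bij_betw inj_on_inverseI[of _ point]) (rule point_address)
  show "address -` A' \<inter> ?X \<in> Bor K \<tau>"
    if A': "A' \<in> {address ` ?X \<inter> A | A. A \<in> Bor K bounded_topology}" for A'
  proof -
    obtain A where A: "A \<in> Bor K bounded_topology" "A' = address ` ?X \<inter> A"
      using A' by blast
    then have "address -` A' \<inter> ?X = address -` A \<inter> ?X"
      by blast
    then show ?thesis
      using address_measurable[OF A(1)] by simp
  qed
  show "address ` A \<in> {address ` ?X \<inter> A | A. A \<in> Bor K bounded_topology}" if "A \<in> Bor K \<tau>" for A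
  proof -
    have "A \<subseteq> ?X"
      by (rule kplus_algebra_subset[OF kplus_algebra_Bor that])
    then have "address ` A = address ` ?X \<inter> {y \<in> live. point y \<in> A}"
      using address_live point_address by force
    then show ?thesis
      using point_measurable[OF that] by blast
  qed
qed

end

lemma (in admissible_cardinal) fSC_imp_standard:
  assumes "fSC_space K \<tau>"
  shows "standard_kBorel K (topspace \<tau>) (Bor K \<tau>)"
proof -
  obtain \<sigma> :: "('k, 'a) strategy" where \<sigma>: "winning_fair \<tau> \<sigma>"
    using assms by (auto simp: fSC_space_def)
  obtain \<U> where \<U>: "|\<U>| \<le>o kappa K" "\<And>U. U \<in> \<U> \<Longrightarrow> openin \<tau> U"
    "\<And>U x. openin \<tau> U \<Longrightarrow> x \<in> U \<Longrightarrow> \<exists>V\<in>\<U>. x \<in> V \<and> V \<subseteq> U"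
    using assms unfolding fSC_space_def weight_le_def by metis
  have "|insert {} \<U>| \<le>o kappa K"
    using le_kappa_Un[OF le_kappa_finite[of "{{}}"] \<U>(1)] by simp
  then obtain B :: "'k \<Rightarrow> 'a set" where B: "range B = insert {} \<U>"
    using kappa_enumeration by blast
  obtain p :: "'k \<times> 'k \<Rightarrow> 'k" where "bij p"
    using pairing .
  then have surj: "surj (inv p)"
    by (simp add: bij_imp_bij_inv bij_is_surj)
  interpret fair_game K \<tau> \<sigma> B "inv p"
  proof
    show "openin \<tau> (B i)" for i
      using B \<U>(2) by (metis insertE openin_empty rangeI)
    show "\<exists>i. x \<in> B i \<and> B i \<subseteq> U" if U: "openin \<tau> U" "x \<in> U" for U x
    proof -
      obtain V where "V \<in> \<U>" "x \<in> V" "V \<subseteq> U"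
        using \<U>(3) U by blast
      moreover have "V \<in> range B"
        using B \<open>V \<in> \<U>\<close> by simp
      ultimately show ?thesis
        by blast
    qed
  qed (use assms \<sigma> surj in \<open>auto simp: fSC_space_def\<close>)
  show ?thesis
    by (rule standard)
qed

section \<open>Closed representations of standard spaces\<close>

context admissible_cardinal
begin

lemma recode:
  assumes "|UNIV :: 'b set| \<le>o kappa K" "inj (j :: 'k \<Rightarrow> 'b)"
  obtains c :: "'k \<Rightarrow> 'b" where "bij c"
proof -
  have "|UNIV :: 'k set| \<le>o |UNIV :: 'b set|"
    using assms(2) card_of_ordLeq[of "UNIV :: 'k set" "UNIV :: 'b set"] by blast
  then have "|UNIV :: 'k set| =o |UNIV :: 'b set|"
    using assms(1) card_UNIV_le[of "UNIV :: 'b set"] by (simp add: ordIso_iff_ordLeq)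
  then show thesis
    using that card_of_ordIso[of "UNIV :: 'k set" "UNIV :: 'b set"] by blast
qed

lemma le_kappa_pairs: "|UNIV :: ('k \<times> 'k) set| \<le>o kappa K"
  using le_kappa_Times[OF le_kappa_index le_kappa_index, of UNIV UNIV] by simp

lemma le_kappa_option: "|UNIV :: 'b set| \<le>o kappa K \<Longrightarrow> |UNIV :: 'b option set| \<le>o kappa K"
  using le_kappa_Un[OF le_kappa_finite[of "{None}"] le_kappa_image[of UNIV Some]]
  by (simp add: UNIV_option_conv)

lemma le_kappa_sum: "|UNIV :: ('k + 'k) set| \<le>o kappa K"
  using le_kappa_Un[OF le_kappa_image[OF le_kappa_index] le_kappa_image[OF le_kappa_index],
      of Inl UNIV Inr UNIV]
  by (simp add: UNIV_sum)

lemma small_Un: "|A| <o kappa K \<Longrightarrow> |B| <o kappa K \<Longrightarrow> |A \<union> B| <o kappa K"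
  by (rule Un_Cinfinite_bound_strict[OF _ _ Cinfinite_kappa])

text \<open>
  Closedness in \<open>\<^sup>\<kappa>\<kappa>\<close> is expressed with arbitrary sets of fewer than \<open>\<kappa>\<close> coordinates
  in place of initial segments. By regularity this is the same, and it does not depend on the order
  of the coordinates, so that coordinates can be rearranged by any bijection.
\<close>

definition closed_graph :: "(('k \<Rightarrow> 'k) \<Rightarrow> 'k \<Rightarrow> 'k) \<Rightarrow> bool"
  where "closed_graph h \<longleftrightarrow>
    (\<forall>x y. (\<forall>S. |S| <o kappa K \<longrightarrow> (\<exists>x'. \<forall>\<beta>\<in>S. x' \<beta> = x \<beta> \<and> h x' \<beta> = y \<beta>)) \<longrightarrow> h x = y)"

lemma closed_graphD:
  assumes "closed_graph h"
    and "\<And>S. |S| <o kappa K \<Longrightarrow> \<exists>x'. \<forall>\<beta>\<in>S. x' \<beta> = x \<beta> \<and> h x' \<beta> = y \<beta>"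
  shows "h x = y"
  using assms unfolding closed_graph_def by simp

text \<open>
  Membership in \<open>A\<close> can be read off one coordinate of a Borel function with closed graph. In the graph,
  the part above \<open>A\<close> is then relatively clopen, and projects injectively onto \<open>A\<close>.
\<close>

definition captured :: "('k \<Rightarrow> 'k) set \<Rightarrow> bool"
  where "captured A \<longleftrightarrow>
    (\<exists>h i T. coordinatewise_in (Bor K bounded_topology) UNIV h \<and> closed_graph h \<and>
      A = {x. h x i \<in> T})"

lemma coordinate_set_in_Bor:
  fixes h :: "('k \<Rightarrow> 'k) \<Rightarrow> 'k \<Rightarrow> 'k"
  assumes "coordinatewise_in (Bor K bounded_topology) UNIV h"
  shows "{x. h x i \<in> T} \<in> Bor K (bounded_topology :: ('k \<Rightarrow> 'k) topology)"
proof -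
  have "(\<Union>v\<in>T. {x \<in> UNIV. h x i = v}) \<in> Bor K (bounded_topology :: ('k \<Rightarrow> 'k) topology)"
    using assms by (intro kplus_algebra_UN[OF kplus_algebra_Bor le_kappa_index]) (simp add: coordinatewise_in_def)
  moreover have "(\<Union>v\<in>T. {x \<in> UNIV. h x i = v}) = {x. h x i \<in> T}"
    by auto
  ultimately show ?thesis
    by simp
qed

lemma captured_coordinate: "captured {x. x i = v}"
proof -
  have "coordinatewise_in (Bor K bounded_topology) UNIV (\<lambda>x::'k \<Rightarrow> 'k. x)"
    using coordinate_in_Bor by (simp add: coordinatewise_in_def)
  moreover have "closed_graph (\<lambda>x. x)"
    unfolding closed_graph_def
  proof (intro allI impI ext)
    fix x y :: "'k \<Rightarrow> 'k" and i
    assume "\<forall>S. |S| <o kappa K \<longrightarrow> (\<exists>x'. \<forall>\<beta>\<in>S. x' \<beta> = x \<beta> \<and> x' \<beta> = y \<beta>)"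
    then show "x i = y i"
      using finite_less_kappa[of "{i}"] by fastforce
  qed
  ultimately show ?thesis
    unfolding captured_def by (intro exI[of _ "\<lambda>x. x"] exI[of _ i] exI[of _ "{v}"]) simp
qed

text \<open>
  For the union of the sets \<open>{x. h i x (a i) \<in> T i}\<close> all the \<open>h i\<close> are recorded, together with the
  least \<open>i\<close> for which \<open>x\<close> belongs to the \<open>i\<close>th set. The graph remains closed because membership
  in the first sets up to the least index depends on fewer than \<open>\<kappa>\<close> recorded coordinates.
\<close>

lemma captured_UN:
  fixes A :: "'k \<Rightarrow> ('k \<Rightarrow> 'k) set"
  assumes "\<And>i. captured (A i)"
  shows "captured (\<Union>i. A i)"
proof -
  have "\<forall>i. \<exists>h a T. coordinatewise_in (Bor K bounded_topology) UNIV h \<and> closed_graph h \<and>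
      A i = {x. h x a \<in> T}"
    using assms by (simp add: captured_def)
  then obtain h a T where h: "\<And>i. coordinatewise_in (Bor K bounded_topology) UNIV (h i)"
      "\<And>i. closed_graph (h i)" and A: "\<And>i. A i = {x. h i x (a i) \<in> T i}"
    by metis
  obtain c :: "'k \<Rightarrow> ('k \<times> 'k) option" where c: "bij c"
    using recode[of "\<lambda>i. Some (i, i)"] le_kappa_option[OF le_kappa_pairs] by (auto simp: inj_def)
  define d where "d = inv c"
  have cd [simp]: "c (d s) = s" and dc: "d (c i) = i" for s i
    using c by (simp_all add: d_def bij_is_surj surj_f_inv_f bij_is_inj)
  obtain v' :: "'k \<Rightarrow> 'k option" where v': "bij v'"
    using recode[of Some] le_kappa_option[OF le_kappa_index] by auto
  define v where "v = inv v'"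
  have v_eq: "v s = w \<longleftrightarrow> v' w = s" for s w
    unfolding v_def using bij_inv_eq_iff[OF v', of w s] by auto
  have v: "v s = v t \<longleftrightarrow> s = t" for s t
    using v_eq[of t "v t"] by (auto simp: v_eq)
  define first where "first x = (if \<exists>i. x \<in> A i then Some (LEAST i. x \<in> A i) else None)" for x
  define H where "H x \<alpha> = (case c \<alpha> of None \<Rightarrow> v (first x) | Some (i, \<beta>) \<Rightarrow> h i x \<beta>)" for x \<alpha>
  have H_first: "H x (d None) = v (first x)" and H_h: "H x (d (Some (i, \<beta>))) = h i x \<beta>" for x i \<beta>
    by (simp_all add: H_def)
  have first_Some: "first x = Some j \<longleftrightarrow> x \<in> A j \<and> (\<forall>i<j. x \<notin> A i)" for x j
  proof
    assume "first x = Some j"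
    then show "x \<in> A j \<and> (\<forall>i<j. x \<notin> A i)"
      unfolding first_def by (metis LeastI_ex not_less_Least option.distinct(1) option.inject)
  next
    assume j: "x \<in> A j \<and> (\<forall>i<j. x \<notin> A i)"
    then have "(LEAST i. x \<in> A i) = j"
      by (intro Least_equality) (auto simp: not_less[symmetric])
    then show "first x = Some j"
      using j by (auto simp: first_def)
  qed
  have first_None: "first x = None \<longleftrightarrow> (\<forall>i. x \<notin> A i)" for x
    by (simp add: first_def)
  have A_in: "A i \<in> Bor K bounded_topology" for i
    unfolding A by (rule coordinate_set_in_Bor[OF h(1)])
  have "coordinatewise_in (Bor K bounded_topology) UNIV H"
    unfolding coordinatewise_in_def
  proof (intro allI)
    fix \<alpha> w
    consider "c \<alpha> = None" "v' w = None" | j where "c \<alpha> = None" "v' w = Some j"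
      | i \<beta> where "c \<alpha> = Some (i, \<beta>)"
      by (metis not_None_eq surj_pair)
    then show "{x \<in> UNIV. H x \<alpha> = w} \<in> Bor K bounded_topology"
    proof cases
      case 1
      then have "H x \<alpha> = w \<longleftrightarrow> first x = None" for x
        by (auto simp: H_def v_eq)
      then have "{x \<in> UNIV. H x \<alpha> = w} = topspace bounded_topology - (\<Union>i. A i)"
        by (auto simp: first_None)
      also have "\<dots> \<in> Bor K bounded_topology"
        by (intro kplus_algebra_compl[OF kplus_algebra_Bor] kplus_algebra_UN[OF kplus_algebra_Bor]
            le_kappa_index A_in)
      finally show ?thesis .
    next
      case (2 j)
      then have "H x \<alpha> = w \<longleftrightarrow> first x = Some j" for x
        by (auto simp: H_def v_eq)
      then have "{x \<in> UNIV. H x \<alpha> = w} = A j - (\<Union>i\<in>{..<j}. A i)"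
        by (auto simp: first_Some)
      also have "\<dots> \<in> Bor K bounded_topology"
        by (intro kplus_algebra_Diff[OF kplus_algebra_Bor] kplus_algebra_UN[OF kplus_algebra_Bor]
            le_kappa_index A_in)
      finally show ?thesis .
    next
      case (3 i \<beta>)
      then show ?thesis
        using h(1)[of i] by (simp add: H_def coordinatewise_in_def)
    qed
  qed
  moreover have "closed_graph H"
    unfolding closed_graph_def
  proof (intro allI impI)
    fix x y
    assume "\<forall>S. |S| <o kappa K \<longrightarrow> (\<exists>x'. \<forall>\<beta>\<in>S. x' \<beta> = x \<beta> \<and> H x' \<beta> = y \<beta>)"
    then have lim: "\<exists>x'. \<forall>\<beta>\<in>S. x' \<beta> = x \<beta> \<and> H x' \<beta> = y \<beta>" if "|S| <o kappa K" for S
      using that by blast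
    have y_h: "h i x = (\<lambda>\<beta>. y (d (Some (i, \<beta>))))" for i
    proof -
      have "\<exists>x'. \<forall>\<beta>\<in>S. x' \<beta> = x \<beta> \<and> h i x' \<beta> = y (d (Some (i, \<beta>)))" if S: "|S| <o kappa K" for S
      proof -
        have "|S \<union> (\<lambda>\<beta>. d (Some (i, \<beta>))) ` S| <o kappa K"
          by (intro small_Un small_image S)
        from lim[OF this] obtain x' where
          "\<forall>\<beta>\<in>S \<union> (\<lambda>\<beta>. d (Some (i, \<beta>))) ` S. x' \<beta> = x \<beta> \<and> H x' \<beta> = y \<beta>" ..
        then have "\<forall>\<beta>\<in>S. x' \<beta> = x \<beta> \<and> h i x' \<beta> = y (d (Some (i, \<beta>)))"
          by (simp add: ball_Un H_h)
        then show ?thesis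
          by blast
      qed
      then show ?thesis
        by (rule closed_graphD[OF h(2)])
    qed
    have y_A: "x \<in> A i \<longleftrightarrow> y (d (Some (i, a i))) \<in> T i" for i
      by (simp add: A y_h)
    have approx: "\<exists>x'. y (d None) = v (first x') \<and> (\<forall>i\<in>I. x' \<in> A i \<longleftrightarrow> x \<in> A i)"
      if I: "|I| <o kappa K" for I
    proof -
      have "|{d None} \<union> (\<lambda>i. d (Some (i, a i))) ` I| <o kappa K"
        by (intro small_Un small_image I finite_less_kappa) simp
      from lim[OF this] obtain x' where
        x': "\<forall>\<beta>\<in>{d None} \<union> (\<lambda>i. d (Some (i, a i))) ` I. x' \<beta> = x \<beta> \<and> H x' \<beta> = y \<beta>" ..
      then have "y (d None) = v (first x')"
        by (simp add: H_first)
      moreover have "x' \<in> A i \<longleftrightarrow> x \<in> A i" if "i \<in> I" for i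
        using x' that unfolding y_A by (simp add: A H_h ball_Un)
      ultimately show ?thesis
        by blast
    qed
    have "y (d None) = v (first x)"
    proof (cases "first x")
      case None
      obtain x\<^sub>1 where x\<^sub>1: "y (d None) = v (first x\<^sub>1)"
        using approx[OF finite_less_kappa, of "{}"] by auto
      show ?thesis
      proof (cases "first x\<^sub>1")
        case (Some j)
        obtain x\<^sub>2 where "y (d None) = v (first x\<^sub>2)" "x\<^sub>2 \<in> A j \<longleftrightarrow> x \<in> A j"
          using approx[OF finite_less_kappa, of "{j}"] by auto
        moreover from this have "first x\<^sub>2 = Some j"
          using x\<^sub>1 Some by (simp add: v)
        ultimately show ?thesis
          using None by (simp add: first_Some first_None)
      qed (simp add: x\<^sub>1 None)
    next
      case (Some j)
      obtain j' where j': "j < j'"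
        using no_top by blast
      obtain x' where "y (d None) = v (first x')" "\<forall>i\<in>{..<j'}. x' \<in> A i \<longleftrightarrow> x \<in> A i"
        using approx[OF card_initial_segment] by blast
      moreover from this have "first x' = Some j"
        using Some j' unfolding first_Some by (meson lessThan_iff less_trans)
      ultimately show ?thesis
        using Some by simp
    qed
    then have "H x (d s) = y (d s)" for s
      using y_h by (cases s) (auto simp: H_def)
    from this[of "c _"] show "H x = y"
      by (simp add: dc fun_eq_iff)
  qed
  moreover have "(\<Union>i. A i) = {x. H x (d None) \<in> range (\<lambda>i. v (Some i))}"
  proof -
    have "x \<in> (\<Union>i. A i) \<longleftrightarrow> (\<exists>i. first x = Some i)" for x
      using first_None[of x] not_None_eq[of "first x"] by simp
    moreover have "v s \<in> range (\<lambda>i. v (Some i)) \<longleftrightarrow> (\<exists>i. s = Some i)" for s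
      by (auto simp: image_iff v)
    ultimately show ?thesis
      by (intro set_eqI) (simp only: H_first mem_Collect_eq)
  qed
  ultimately show ?thesis
    unfolding captured_def by (intro exI[of _ H] exI[of _ "d None"] exI[of _ "range (\<lambda>i. v (Some i))"] conjI)
qed

text \<open>
  Captured sets form an algebra containing the sets \<open>{x. x i = v}\<close>, and these generate
  the Borel sets.
\<close>

lemma Bor_captured:
  assumes "A \<in> Bor K (bounded_topology :: ('k \<Rightarrow> 'k) topology)"
  shows "captured A"
proof -
  have compl: "captured (UNIV - A)" if "captured A" for A
  proof -
    obtain h i T where "coordinatewise_in (Bor K bounded_topology) UNIV h" "closed_graph h"
      "A = {x. h x i \<in> T}"
      using \<open>captured A\<close> by (auto simp: captured_def)
    moreover from this have "UNIV - A = {x. h x i \<in> - T}"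
      by auto
    ultimately show ?thesis
      unfolding captured_def by blast
  qed
  have "captured (\<Union>\<F>)" if \<F>: "\<F> \<subseteq> Collect captured" "|\<F>| \<le>o kappa K" for \<F>
  proof (cases "\<F> = {}")
    case True
    have "captured (\<Union>v. {x. x i = v})" for i
      by (intro captured_UN captured_coordinate)
    moreover have "(\<Union>v. {x :: 'k \<Rightarrow> 'k. x i = v}) = UNIV" for i
      by auto
    ultimately have "captured UNIV"
      by (simp only:)
    then show ?thesis
      using compl[of UNIV] True by simp
  next
    case False
    then obtain f :: "'k \<Rightarrow> _" where "range f = \<F>"
      using kappa_enumeration \<F>(2) by blast
    then show ?thesis
      using captured_UN[of f] \<F>(1) by auto
  qed
  then have "kplus_algebra K UNIV (Collect captured)"
    using compl by (simp add: kplus_algebra_def)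
  moreover have "coordinatewise_in (Collect captured) UNIV (\<lambda>x::'k \<Rightarrow> 'k. x)"
    using captured_coordinate by (simp add: coordinatewise_in_def)
  ultimately have "(\<lambda>x. x) -` A \<inter> UNIV \<in> Collect captured"
    using assms by (rule Bor_preimage_coordinatewise)
  then show ?thesis
    by simp
qed

text \<open>
  Equivalently, \<open>g\<close> is an isomorphism of \<open>(X, \<B>)\<close> onto its range with the traces of Borel sets.
\<close>

definition represents :: "('a \<Rightarrow> 'k \<Rightarrow> 'k) \<Rightarrow> 'a set \<Rightarrow> 'a set set \<Rightarrow> bool"
  where "represents g X \<B> \<longleftrightarrow>
    inj_on g X \<and> \<B> = {g -` A \<inter> X | A. A \<in> Bor K bounded_topology}"

text \<open>
  If \<open>f\<close> is an isomorphism onto \<open>B\<close> and \<open>h\<close> captures \<open>B\<close>, then \<open>z\<close> is represented by the pair of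
  \<open>f z\<close> and \<open>h (f z)\<close>, coded as one sequence. These pairs form the part of a closed graph where one
  coordinate lies in \<open>T\<close>, and this is a closed set.
\<close>

lemma closed_representation:
  assumes alg: "kplus_algebra K X \<B>" and standard: "standard_kBorel K X \<B>"
  obtains g where "represents g X \<B>"
    and "\<And>y. (\<And>\<alpha>. \<exists>p\<in>g ` X. agree \<alpha> p y) \<Longrightarrow> y \<in> g ` X"
proof -
  obtain B f where B: "B \<in> Bor K (bounded_topology :: ('k \<Rightarrow> 'k) topology)"
    and f: "kBorel_isomorphism X \<B> B {B \<inter> A | A. A \<in> Bor K (bounded_topology :: ('k \<Rightarrow> 'k) topology)} f"
    using standard by (auto simp: standard_kBorel_def)
  have bij: "bij_betw f X B"
    using f by (simp only: kBorel_isomorphism_def)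
  have f_vimage: "f -` (B \<inter> A) \<inter> X \<in> \<B>" if "A \<in> Bor K bounded_topology" for A
  proof -
    have "B \<inter> A \<in> {B \<inter> A | A. A \<in> Bor K (bounded_topology :: ('k \<Rightarrow> 'k) topology)}"
      using \<open>A \<in> Bor K bounded_topology\<close> by blast
    with f show ?thesis
      by (simp only: kBorel_isomorphism_def)
  qed
  have f_image: "\<exists>A'\<in>Bor K bounded_topology. f ` A = B \<inter> A'" if "A \<in> \<B>" for A
  proof -
    have "f ` A \<in> {B \<inter> A | A. A \<in> Bor K (bounded_topology :: ('k \<Rightarrow> 'k) topology)}"
      using f \<open>A \<in> \<B>\<close> by (simp only: kBorel_isomorphism_def)
    then show ?thesis
      by blast
  qed
  have fX: "f x \<in> B" if "x \<in> X" for x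
    using bij that by (auto simp: bij_betw_def)
  have f_measurable: "{x \<in> X. f x \<in> A} \<in> \<B>" if "A \<in> Bor K bounded_topology" for A
  proof -
    have "f -` (B \<inter> A) \<inter> X = {x \<in> X. f x \<in> A}"
      using fX by auto
    then show ?thesis
      using f_vimage[OF that] by simp
  qed
  obtain h i T where h: "coordinatewise_in (Bor K bounded_topology) UNIV h" "closed_graph h"
    and B_eq: "B = {x. h x i \<in> T}"
    using Bor_captured[OF B] by (auto simp: captured_def)
  obtain c :: "'k \<Rightarrow> 'k + 'k" where c: "bij c"
    using recode[of Inl] le_kappa_sum by auto
  define d where "d = inv c"
  have cd [simp]: "c (d s) = s" and dc: "d (c i) = i" for s i
    using c by (simp_all add: d_def bij_is_surj surj_f_inv_f bij_is_inj)
  define g where "g z \<alpha> = (case c \<alpha> of Inl \<beta> \<Rightarrow> f z \<beta> | Inr \<beta> \<Rightarrow> h (f z) \<beta>)" for z \<alpha>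
  have g_Inl [simp]: "g z (d (Inl \<beta>)) = f z \<beta>" and g_Inr [simp]: "g z (d (Inr \<beta>)) = h (f z) \<beta>" for z \<beta>
    by (simp_all add: g_def)
  have inj: "inj_on g X"
  proof (rule inj_onI)
    fix z z' assume "z \<in> X" "z' \<in> X" "g z = g z'"
    then have "f z = f z'"
      by (metis g_Inl ext)
    then show "z = z'"
      using bij \<open>z \<in> X\<close> \<open>z' \<in> X\<close> by (auto simp: bij_betw_def inj_on_def)
  qed
  have "coordinatewise_in \<B> X g"
    unfolding coordinatewise_in_def
  proof (intro allI)
    fix \<alpha> v
    show "{x \<in> X. g x \<alpha> = v} \<in> \<B>"
    proof (cases "c \<alpha>")
      case (Inl \<beta>)
      then show ?thesis
        using f_measurable[OF coordinate_in_Bor[of \<beta> v]] by (simp add: g_def)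
    next
      case (Inr \<beta>)
      have "{y. h y \<beta> = v} \<in> Bor K bounded_topology"
        using h(1) by (simp add: coordinatewise_in_def)
      from f_measurable[OF this] show ?thesis
        using Inr by (simp add: g_def)
    qed
  qed
  then have measurable: "g -` A \<inter> X \<in> \<B>" if "A \<in> Bor K bounded_topology" for A
    using Bor_preimage_coordinatewise[OF alg] that by blast
  have "\<exists>A'\<in>Bor K bounded_topology. A = g -` A' \<inter> X" if A: "A \<in> \<B>" for A
  proof -
    obtain A' where A': "A' \<in> Bor K bounded_topology" "f ` A = B \<inter> A'"
      using f_image[OF A] by blast
    define \<pi> where "\<pi> y \<beta> = y (d (Inl \<beta>))" for y :: "'k \<Rightarrow> 'k" and \<beta>
    have "coordinatewise_in (Bor K bounded_topology) (topspace bounded_topology) \<pi>"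
      using coordinate_in_Bor by (simp add: coordinatewise_in_def \<pi>_def)
    then have "\<pi> -` A' \<inter> topspace bounded_topology \<in> Bor K bounded_topology"
      by (rule Bor_preimage_coordinatewise[OF kplus_algebra_Bor _ A'(1)])
    moreover have "A = g -` (\<pi> -` A' \<inter> topspace bounded_topology) \<inter> X"
    proof -
      have "\<pi> (g z) = f z" for z
        by (simp add: \<pi>_def fun_eq_iff)
      moreover have "f z \<in> A' \<longleftrightarrow> z \<in> A" if "z \<in> X" for z
      proof -
        have "A \<subseteq> X"
          by (rule kplus_algebra_subset[OF alg A])
        then have "f z \<in> f ` A \<longleftrightarrow> z \<in> A"
          using bij that inj_on_image_mem_iff[of f X z A] by (auto simp: bij_betw_def)
        then show ?thesis
          using A'(2) fX[OF that] by simp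
      qed
      ultimately show ?thesis
        using kplus_algebra_subset[OF alg A] by auto
    qed
    ultimately show ?thesis
      by blast
  qed
  then have "represents g X \<B>"
    using inj measurable unfolding represents_def by blast
  moreover have "y \<in> g ` X" if y: "\<And>\<alpha>. \<exists>p\<in>g ` X. agree \<alpha> p y" for y
  proof -
    have lim: "\<exists>z\<in>X. \<forall>\<beta>\<in>S. g z \<beta> = y \<beta>" if S: "|S| <o kappa K" for S
    proof -
      obtain \<alpha> where "\<forall>\<beta>\<in>S. \<beta> < \<alpha>"
        using bounded_if_small[OF S] by blast
      then show ?thesis
        using y[of \<alpha>] by (auto simp: agree_def)
    qed
    have graph: "h (\<lambda>\<beta>. y (d (Inl \<beta>))) = (\<lambda>\<beta>. y (d (Inr \<beta>)))"
    proof -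
      have "\<exists>x'. \<forall>\<beta>\<in>S. x' \<beta> = y (d (Inl \<beta>)) \<and> h x' \<beta> = y (d (Inr \<beta>))" if S: "|S| <o kappa K" for S
      proof -
        have "|(\<lambda>\<beta>. d (Inl \<beta>)) ` S \<union> (\<lambda>\<beta>. d (Inr \<beta>)) ` S| <o kappa K"
          by (intro small_Un small_image S)
        from lim[OF this] obtain z
          where "\<forall>\<beta>\<in>(\<lambda>\<beta>. d (Inl \<beta>)) ` S \<union> (\<lambda>\<beta>. d (Inr \<beta>)) ` S. g z \<beta> = y \<beta>"
          by blast
        then show ?thesis
          by (intro exI[of _ "f z"]) (simp add: ball_Un)
      qed
      then show ?thesis
        by (rule closed_graphD[OF h(2)])
    qed
    obtain z where "z \<in> X" "g z (d (Inr i)) = y (d (Inr i))"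
      using lim[OF finite_less_kappa, of "{d (Inr i)}"] by auto
    moreover have "h (f z) i \<in> T"
      using fX[OF \<open>z \<in> X\<close>] unfolding B_eq by simp
    ultimately have "y (d (Inr i)) \<in> T"
      by simp
    then have "(\<lambda>\<beta>. y (d (Inl \<beta>))) \<in> B"
      by (simp add: B_eq graph)
    then obtain z where z: "z \<in> X" "f z = (\<lambda>\<beta>. y (d (Inl \<beta>)))"
      using bij by (auto simp: bij_betw_def)
    have "g z \<alpha> = y \<alpha>" for \<alpha>
    proof (cases "c \<alpha>")
      case (Inl \<beta>)
      then show ?thesis
        using z(2) dc[of \<alpha>] by (simp add: g_def)
    next
      case (Inr \<beta>)
      then show ?thesis
        using z(2) graph dc[of \<alpha>] by (simp add: g_def)
    qed
    then have "g z = y" ..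
    then show ?thesis
      using z(1) by blast
  qed
  ultimately show thesis
    by (rule that)
qed

end

section \<open>Superclosed representations\<close>

text \<open>
  For unbounded \<open>E\<close> this says that \<open>Q\<close> is closed. For bounded \<open>E\<close> without maximum it says that a
  sequence of limit length extends into \<open>Q\<close> once all its proper initial segments do. In
  other words, \<open>Q\<close> is the set of branches of a tree without terminal nodes that is closed under
  unions of short chains.
\<close>

definition superclosed :: "('k::ord \<Rightarrow> 'b) set \<Rightarrow> bool"
  where "superclosed Q \<longleftrightarrow>
    (\<forall>y E. E \<noteq> {} \<and> (\<forall>e\<in>E. \<exists>p\<in>Q. agree e p y) \<longrightarrow> (\<exists>p\<in>Q. \<forall>e\<in>E. agree e p y))"

context admissible_cardinal
begin

lemma superclosed_constants: "superclosed {(\<lambda>_::'k. t :: 'k) | t. t \<in> T}"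
  unfolding superclosed_def
proof (intro allI impI)
  fix y :: "'k \<Rightarrow> 'k" and E
  assume E: "E \<noteq> {} \<and> (\<forall>e\<in>E. \<exists>p\<in>{\<lambda>_. t | t. t \<in> T}. agree e p y)"
  then have approx: "\<exists>t\<in>T. agree e (\<lambda>_. t) y" if "e \<in> E" for e
    using that by blast
  show "\<exists>p\<in>{\<lambda>_. t | t. t \<in> T}. \<forall>e\<in>E. agree e p y"
  proof (cases "\<exists>e\<in>E. \<exists>\<beta>. \<beta> < e")
    case True
    then obtain e \<beta> where e: "e \<in> E" "\<beta> < e"
      by blast
    obtain t where t: "t \<in> T" "agree e (\<lambda>_. t) y"
      using approx[OF e(1)] by blast
    have "agree e' (\<lambda>_. t) y" if e': "e' \<in> E" for e'
    proof -
      obtain t' where t': "agree e' (\<lambda>_. t') y"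
        using approx[OF e'] by blast
      show ?thesis
        unfolding agree_def
      proof (intro allI impI)
        fix \<beta>' assume \<beta>': "\<beta>' < e'"
        have "min \<beta> \<beta>' < e" "min \<beta> \<beta>' < e'"
          using e(2) \<beta>' by (auto simp: min_less_iff_disj)
        then have "t = y (min \<beta> \<beta>')" "t' = y (min \<beta> \<beta>')"
          using t(2) t' unfolding agree_def by blast+
        moreover have "t' = y \<beta>'"
          using t' \<beta>' unfolding agree_def by blast
        ultimately show "t = y \<beta>'"
          by (simp only:)
      qed
    qed
    then show ?thesis
      using t(1) by blast
  next
    case False
    obtain e where "e \<in> E"
      using E by blast
    then obtain t where "t \<in> T"
      using approx by blast
    moreover have "agree e (\<lambda>_. t) y" if "e \<in> E" for e
      using False that by (auto simp: agree_def)
    ultimately show ?thesis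
      by blast
  qed
qed

text \<open>
  A closed set \<open>C\<close> becomes superclosed when a single branch is added above each sequence that is not
  extended by an element of \<open>C\<close>, although all its proper initial segments are. There are at
  most \<open>\<kappa>\<^sup><\<^sup>\<kappa> = \<kappa>\<close> such sequences.
\<close>

lemma superclosed_extension:
  fixes C :: "('k \<Rightarrow> 'k) set"
  assumes C: "\<And>y. (\<And>\<alpha>. \<exists>c\<in>C. agree \<alpha> c y) \<Longrightarrow> y \<in> C"
  obtains D where "|D| \<le>o kappa K" "C \<inter> D = {}" "superclosed (C \<union> D)"
proof
  define dead where "dead \<gamma> y \<longleftrightarrow> \<not> (\<exists>c\<in>C. agree \<gamma> c y) \<and> (\<forall>\<alpha><\<gamma>. \<exists>c\<in>C. agree \<alpha> c y)" for \<gamma> y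
  define pad where "pad \<gamma> y = (\<lambda>\<beta>. if \<beta> < \<gamma> then y \<beta> else undefined)" for \<gamma> :: 'k and y :: "'k \<Rightarrow> 'k"
  define D where "D = {pad \<gamma> y | \<gamma> y. dead \<gamma> y}"
  have pad: "agree \<gamma> (pad \<gamma> y) y" for \<gamma> y
    by (simp add: agree_def pad_def)
  have D_subset: "D \<subseteq> (\<lambda>(\<gamma>, s). pad \<gamma> s) ` range (\<lambda>(\<alpha>::'k, s::'k \<Rightarrow> 'k). (\<alpha>, restrict s {..<\<alpha>}))"
  proof
    fix p assume "p \<in> D"
    then obtain \<gamma> y where "p = pad \<gamma> y"
      unfolding D_def by blast
    then have "p = (\<lambda>(\<gamma>, s). pad \<gamma> s) ((\<lambda>(\<alpha>, s). (\<alpha>, restrict s {..<\<alpha>})) (\<gamma>, y))"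
      by (auto simp: pad_def)
    then show "p \<in> (\<lambda>(\<gamma>, s). pad \<gamma> s) ` range (\<lambda>(\<alpha>::'k, s::'k \<Rightarrow> 'k). (\<alpha>, restrict s {..<\<alpha>}))"
      by (blast intro: image_eqI)
  qed
  show "|D| \<le>o kappa K"
    by (rule le_kappa_subset[OF D_subset le_kappa_image[OF le_kappa_sequences]])
  have "p \<notin> C" if "p \<in> D" for p
  proof
    assume "p \<in> C"
    obtain \<gamma> y where "p = pad \<gamma> y" "dead \<gamma> y"
      using \<open>p \<in> D\<close> unfolding D_def by blast
    then show False
      using \<open>p \<in> C\<close> pad[of \<gamma> y] by (simp add: dead_def)
  qed
  then show "C \<inter> D = {}"
    by blast
  show "superclosed (C \<union> D)"
    unfolding superclosed_def
  proof (intro allI impI)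
    fix y E assume "E \<noteq> {} \<and> (\<forall>e\<in>E. \<exists>p\<in>C \<union> D. agree e p y)"
    then have approx: "\<exists>p\<in>C \<union> D. agree e p y" if "e \<in> E" for e
      using that by blast
    show "\<exists>p\<in>C \<union> D. \<forall>e\<in>E. agree e p y"
    proof (cases "\<exists>\<gamma>. \<not> (\<exists>c\<in>C. agree \<gamma> c y)")
      case False
      then have "y \<in> C"
        using C by blast
      then show ?thesis
        by (intro bexI[of _ y]) auto
    next
      case True
      define \<gamma> where "\<gamma> = (LEAST \<gamma>. \<not> (\<exists>c\<in>C. agree \<gamma> c y))"
      have \<gamma>: "\<not> (\<exists>c\<in>C. agree \<gamma> c y)"
        unfolding \<gamma>_def by (rule LeastI_ex[OF True])
      have below: "\<exists>c\<in>C. agree \<alpha> c y" if "\<alpha> < \<gamma>" for \<alpha>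
        using not_less_Least[OF that[unfolded \<gamma>_def]] by blast
      have "dead \<gamma> y"
        using \<gamma> below by (simp add: dead_def)
      then have "pad \<gamma> y \<in> D"
        unfolding D_def by blast
      moreover have "agree e (pad \<gamma> y) y" if e: "e \<in> E" for e
      proof (cases "e \<le> \<gamma>")
        case True
        then show ?thesis
          by (rule agree_mono[OF pad])
      next
        case False
        then have "\<gamma> \<le> e"
          by simp
        obtain p where p: "p \<in> C \<union> D" "agree e p y"
          using approx[OF e] by blast
        from p(2) have p\<gamma>: "agree \<gamma> p y"
          by (rule agree_mono[OF _ \<open>\<gamma> \<le> e\<close>])
        have "p \<in> D"
          using p(1) p\<gamma> \<gamma> by blast
        then obtain \<gamma>' y' where p_eq: "p = pad \<gamma>' y'" and dead': "dead \<gamma>' y'"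
          unfolding D_def by blast
        have p\<gamma>': "agree \<gamma>' y' p"
          unfolding p_eq by (rule agree_sym[OF pad])
        have "\<not> \<gamma>' < \<gamma>"
        proof
          assume "\<gamma>' < \<gamma>"
          then obtain c where "c \<in> C" "agree \<gamma>' c y"
            using below by blast
          moreover have "agree \<gamma>' y y'"
            using agree_trans[OF p\<gamma>' agree_mono[OF p\<gamma> less_imp_le[OF \<open>\<gamma>' < \<gamma>\<close>]]] by (rule agree_sym)
          ultimately have "agree \<gamma>' c y'"
            by (blast intro: agree_trans)
          then show False
            using dead' \<open>c \<in> C\<close> unfolding dead_def by blast
        qed
        moreover have "\<not> \<gamma> < \<gamma>'"
        proof
          assume "\<gamma> < \<gamma>'"
          then obtain c where "c \<in> C" "agree \<gamma> c y'"
            using dead' unfolding dead_def by blast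
          moreover have "agree \<gamma> y' y"
            by (rule agree_trans[OF agree_mono[OF p\<gamma>' less_imp_le[OF \<open>\<gamma> < \<gamma>'\<close>]] p\<gamma>])
          ultimately have "agree \<gamma> c y"
            by (blast intro: agree_trans)
          then show False
            using \<gamma> \<open>c \<in> C\<close> by blast
        qed
        ultimately have "\<gamma>' = \<gamma>"
          by simp
        then have "pad \<gamma> y = p"
          using p\<gamma> by (auto simp: p_eq pad_def agree_def fun_eq_iff)
        then show ?thesis
          using p(2) by simp
      qed
      ultimately show ?thesis
        by blast
    qed
  qed
qed

text \<open>
  In a space with at most \<open>\<kappa>\<close> points all subsets are Borel, as are all sets of at most \<open>\<kappa>\<close>
  points in \<open>\<^sup>\<kappa>\<kappa>\<close>.
\<close>

lemma represents_small:
  assumes space: "kBorel_space K X \<B>" and X: "|X| \<le>o kappa K" and inj: "inj_on g X"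
  shows "represents g X \<B>"
proof -
  have alg: "kplus_algebra K X \<B>"
    using space by (simp add: kBorel_space_def)
  have "g -` A \<inter> X \<in> \<B>" for A
    by (intro small_in_kBorel[OF space] le_kappa_subset[OF _ X]) auto
  moreover have "\<exists>A'. A = g -` A' \<inter> X \<and> A' \<in> Bor K bounded_topology" if "A \<in> \<B>" for A
  proof (intro exI conjI)
    have "A \<subseteq> X"
      by (rule kplus_algebra_subset[OF alg that])
    then show "A = g -` (g ` A) \<inter> X"
      using inj by (auto simp: inj_on_def)
    show "g ` A \<in> Bor K bounded_topology"
      by (rule small_in_Bor[OF le_kappa_image[OF le_kappa_subset[OF \<open>A \<subseteq> X\<close> X]]])
  qed
  ultimately show ?thesis
    using inj unfolding represents_def by blast
qed

lemma represents_modified: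
  assumes space: "kBorel_space K X \<B>" and g: "represents g X \<B>"
    and inj: "inj_on g' X" and R: "R \<subseteq> X" "|R| \<le>o kappa K"
    and eq: "\<And>x. x \<in> X - R \<Longrightarrow> g' x = g x"
  shows "represents g' X \<B>"
proof -
  have alg: "kplus_algebra K X \<B>"
    using space by (simp add: kBorel_space_def)
  have small: "S \<in> \<B>" if "S \<subseteq> R" for S
    using R(1) by (intro small_in_kBorel[OF space] le_kappa_subset[OF that R(2)] order_trans[OF that])
  have "g' -` A \<inter> X \<in> \<B>" if A: "A \<in> Bor K bounded_topology" for A
  proof -
    have "g -` A \<inter> X \<in> \<B>"
      using g A unfolding represents_def by blast
    then have "(g -` A \<inter> X - R) \<union> {x \<in> R. g' x \<in> A} \<in> \<B>"
      by (rule kplus_algebra_Un[OF alg kplus_algebra_Diff[OF alg _ small[OF order_refl]] small]) auto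
    moreover have "g' -` A \<inter> X = (g -` A \<inter> X - R) \<union> {x \<in> R. g' x \<in> A}"
      using R(1) eq by auto
    ultimately show ?thesis
      by simp
  qed
  moreover have "\<exists>A'. S = g' -` A' \<inter> X \<and> A' \<in> Bor K bounded_topology" if S: "S \<in> \<B>" for S
  proof -
    obtain A where A: "A \<in> Bor K bounded_topology" "S = g -` A \<inter> X"
      using g S unfolding represents_def by blast
    define A' where "A' = (A - g' ` R) \<union> g' ` (S \<inter> R)"
    have "g' ` R \<in> Bor K bounded_topology" "g' ` (S \<inter> R) \<in> Bor K bounded_topology"
      using small_in_Bor[OF le_kappa_image[OF R(2)]]
        small_in_Bor[OF le_kappa_image[OF le_kappa_subset[OF Int_lower2 R(2)]]] by blast+
    then have "A' \<in> Bor K bounded_topology"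
      unfolding A'_def
      by (intro kplus_algebra_Un[OF kplus_algebra_Bor] kplus_algebra_Diff[OF kplus_algebra_Bor] A(1))
    moreover have mem: "g' x \<in> g' ` T \<longleftrightarrow> x \<in> T" if "x \<in> X" "T \<subseteq> R" for x T
      using inj_on_image_mem_iff[OF inj that(1)] that(2) R(1) by blast
    have "x \<in> S \<longleftrightarrow> g' x \<in> A'" if x: "x \<in> X" for x
      using mem[OF x, of R] mem[OF x, of "S \<inter> R"] eq[of x] x A(2) by (auto simp: A'_def)
    then have "S = g' -` A' \<inter> X"
      using kplus_algebra_subset[OF alg S] by blast
    ultimately show ?thesis
      by blast
  qed
  ultimately show ?thesis
    using inj unfolding represents_def by blast
qed

text \<open>
  If \<open>X\<close> has at most \<open>\<kappa>\<close> points, it can be represented by constant sequences. Otherwise \<open>X\<close> has a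
  subset \<open>R\<close> with exactly \<open>\<kappa>\<close> points, and the new branches \<open>D\<close> of the superclosed extension are absorbed by
  mapping \<open>R\<close> bijectively onto \<open>g ` R \<union> D\<close>.
\<close>

lemma superclosed_representation:
  assumes space: "kBorel_space K X \<B>" and standard: "standard_kBorel K X \<B>"
  obtains g where "represents g X \<B>" "superclosed (g ` X)"
proof (cases "|X| \<le>o kappa K")
  case True
  then obtain j :: "'a \<Rightarrow> 'k" where j: "inj_on j X"
    using card_UNIV_le[of X] card_of_ordLeq[of X "UNIV :: 'k set"] by blast
  define g where "g x = (\<lambda>_::'k. j x)" for x
  have "inj_on g X"
    using j by (auto simp: g_def inj_on_def fun_eq_iff)
  then have "represents g X \<B>"
    by (rule represents_small[OF space True])
  moreover have "g ` X = {(\<lambda>_::'k. t) | t. t \<in> j ` X}"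
    by (auto simp: g_def)
  then have "superclosed (g ` X)"
    using superclosed_constants[of "j ` X"] by (simp only:)
  ultimately show thesis
    by (rule that)
next
  case False
  have alg: "kplus_algebra K X \<B>"
    using space by (simp add: kBorel_space_def)
  obtain g where g: "represents g X \<B>"
    and closed: "\<And>y. (\<And>\<alpha>. \<exists>p\<in>g ` X. agree \<alpha> p y) \<Longrightarrow> y \<in> g ` X"
    using closed_representation[OF alg standard] by blast
  have inj: "inj_on g X"
    using g by (simp add: represents_def)
  obtain D where D: "|D| \<le>o kappa K" "g ` X \<inter> D = {}" "superclosed (g ` X \<union> D)"
    using superclosed_extension[of "g ` X"] closed by blast
  have "|UNIV :: 'k set| \<le>o |X|"
    using False card_UNIV_le ordLeq_total[OF card_of_Well_order card_of_Well_order] by blast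
  then obtain f :: "'k \<Rightarrow> 'a" where f: "inj f" "range f \<subseteq> X"
    using card_of_ordLeq[of "UNIV :: 'k set" X] by blast
  define R where "R = range f"
  have R: "R \<subseteq> X" "|R| \<le>o kappa K"
    using f(2) le_kappa_image[OF le_kappa_index] by (auto simp: R_def)
  have "|g ` R \<union> D| \<le>o |UNIV :: 'k set|"
    using le_kappa_Un[OF le_kappa_image[OF R(2)] D(1)] card_UNIV_le by blast
  moreover have "|UNIV :: 'k set| \<le>o |R|"
    using f(1) card_of_ordLeq[of "UNIV :: 'k set" R] by (auto simp: R_def)
  ultimately have "|g ` R \<union> D| \<le>o |R|"
    by (rule ordLeq_transitive)
  moreover have "|R| \<le>o |g ` R \<union> D|"
    using inj_on_subset[OF inj R(1)] card_of_ordLeq[of R "g ` R \<union> D"] by blast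
  ultimately have "|R| =o |g ` R \<union> D|"
    by (simp add: ordIso_iff_ordLeq)
  then obtain \<psi> where \<psi>: "bij_betw \<psi> R (g ` R \<union> D)"
    using card_of_ordIso[of R "g ` R \<union> D"] by blast
  define g' where "g' x = (if x \<in> R then \<psi> x else g x)" for x
  have "bij_betw g' R (g ` R \<union> D)"
    using \<psi> by (rule bij_betw_cong[THEN iffD1, rotated]) (simp add: g'_def)
  moreover have "bij_betw g' (X - R) (g ` (X - R))"
    using inj_on_subset[OF inj Diff_subset] by (auto simp: bij_betw_def g'_def inj_on_def)
  moreover have "(g ` R \<union> D) \<inter> g ` (X - R) = {}"
    using inj R(1) D(2) by (auto simp: inj_on_def)
  ultimately have "bij_betw g' (R \<union> (X - R)) (g ` R \<union> D \<union> g ` (X - R))"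
    by (rule bij_betw_combine)
  moreover have "R \<union> (X - R) = X" "g ` R \<union> D \<union> g ` (X - R) = g ` X \<union> D"
    using R(1) by auto
  ultimately have "inj_on g' X" "g' ` X = g ` X \<union> D"
    by (simp_all add: bij_betw_def)
  moreover have "represents g' X \<B>"
    by (rule represents_modified[OF space g \<open>inj_on g' X\<close> R]) (simp add: g'_def)
  ultimately show thesis
    using that D(3) by simp
qed

end

section \<open>The strong Choquet game on a superclosed set\<close>

locale superclosed_space = admissible_cardinal K for K :: "'k::wellorder itself" +
  fixes X :: "'a set" and g :: "'a \<Rightarrow> 'k \<Rightarrow> 'k"
  assumes inj: "inj_on g X" and superclosed: "superclosed (g ` X)"
begin

definition \<tau> :: "'a topology"
  where "\<tau> = pullback_topology X g bounded_topology"

definition N :: "'k \<Rightarrow> 'a \<Rightarrow> 'a set"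
  where "N \<alpha> x = {z \<in> X. agree \<alpha> (g z) (g x)}"

lemma topspace_\<tau> [simp]: "topspace \<tau> = X"
  by (simp add: \<tau>_def topspace_pullback_topology)

lemma N_self: "x \<in> X \<Longrightarrow> x \<in> N \<alpha> x"
  by (simp add: N_def)

lemma N_antimono: "\<alpha> \<le> \<beta> \<Longrightarrow> N \<beta> x \<subseteq> N \<alpha> x"
  unfolding N_def using agree_mono by blast

lemma openin_N: "openin \<tau> (N \<alpha> x)"
proof -
  have "N \<alpha> x = g -` {y. agree \<alpha> y (g x)} \<inter> X"
    by (auto simp: N_def)
  then show ?thesis
    unfolding \<tau>_def openin_pullback_topology using openin_cylinder by blast
qed

lemma openin_\<tau>: "openin \<tau> U \<longleftrightarrow> U \<subseteq> X \<and> (\<forall>x\<in>U. \<exists>\<alpha>. N \<alpha> x \<subseteq> U)"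
proof
  assume U: "openin \<tau> U"
  then obtain W where W: "openin bounded_topology W" "U = g -` W \<inter> X"
    by (auto simp: \<tau>_def openin_pullback_topology)
  have "\<exists>\<alpha>. N \<alpha> x \<subseteq> U" if x: "x \<in> U" for x
  proof -
    obtain \<alpha> where "{y. agree \<alpha> y (g x)} \<subseteq> W"
      using W x unfolding openin_bounded_topology by blast
    then have "N \<alpha> x \<subseteq> U"
      by (auto simp: N_def W(2))
    then show ?thesis ..
  qed
  then show "U \<subseteq> X \<and> (\<forall>x\<in>U. \<exists>\<alpha>. N \<alpha> x \<subseteq> U)"
    using W(2) by blast
next
  assume U: "U \<subseteq> X \<and> (\<forall>x\<in>U. \<exists>\<alpha>. N \<alpha> x \<subseteq> U)"
  then obtain \<alpha> where \<alpha>: "\<And>x. x \<in> U \<Longrightarrow> N (\<alpha> x) x \<subseteq> U"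
    by metis
  have "(\<Union>x\<in>U. N (\<alpha> x) x) = U"
    using \<alpha> N_self U by blast
  moreover have "openin \<tau> (\<Union>x\<in>U. N (\<alpha> x) x)"
    by (intro openin_Union) (auto simp: openin_N)
  ultimately show "openin \<tau> U"
    by simp
qed

lemma openin_compl_N: "openin \<tau> (X - N \<alpha> x)"
  unfolding openin_\<tau>
proof (intro conjI ballI)
  fix z assume z: "z \<in> X - N \<alpha> x"
  have "w \<notin> N \<alpha> x" if "w \<in> N \<alpha> z" for w
  proof
    assume "w \<in> N \<alpha> x"
    then have "agree \<alpha> (g z) (g x)"
      using that agree_trans[OF agree_sym, of \<alpha> "g w" "g z" "g x"] by (simp add: N_def)
    then show False
      using z by (simp add: N_def)
  qed
  then have "N \<alpha> z \<subseteq> X - N \<alpha> x"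
    by (auto simp: N_def)
  then show "\<exists>\<alpha>'. N \<alpha>' z \<subseteq> X - N \<alpha> x" ..
qed auto

lemma regular: "regular_space \<tau>"
  unfolding regular_space_def
proof (intro allI impI)
  fix C a assume C: "closedin \<tau> C \<and> a \<in> topspace \<tau> - C"
  then have "openin \<tau> (X - C)"
    by (simp add: closedin_def)
  then obtain \<alpha> where "N \<alpha> a \<subseteq> X - C"
    using C unfolding openin_\<tau> by auto
  moreover have "C \<subseteq> X"
    using C closedin_subset by fastforce
  ultimately show "\<exists>U V. openin \<tau> U \<and> openin \<tau> V \<and> a \<in> U \<and> C \<subseteq> V \<and> disjnt U V"
    using C N_self[of a \<alpha>]
    by (intro exI[of _ "N \<alpha> a"] exI[of _ "X - N \<alpha> a"]) (auto simp: openin_N openin_compl_N disjnt_iff)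
qed

lemma Hausdorff: "Hausdorff_space \<tau>"
  unfolding Hausdorff_space_def
proof (intro allI impI)
  fix x y assume xy: "x \<in> topspace \<tau> \<and> y \<in> topspace \<tau> \<and> x \<noteq> y"
  then have "g x \<noteq> g y"
    using inj by (auto simp: inj_on_def)
  then obtain \<beta> where \<beta>: "g x \<beta> \<noteq> g y \<beta>"
    by (auto simp: fun_eq_iff)
  obtain \<alpha> where \<alpha>: "\<beta> < \<alpha>"
    using no_top by blast
  have "y \<notin> N \<alpha> x"
    using \<alpha> \<beta> by (auto simp: N_def agree_def)
  then show "\<exists>U V. openin \<tau> U \<and> openin \<tau> V \<and> x \<in> U \<and> y \<in> V \<and> disjnt U V"
    using xy N_self[of x \<alpha>]
    by (intro exI[of _ "N \<alpha> x"] exI[of _ "X - N \<alpha> x"]) (auto simp: openin_N openin_compl_N disjnt_iff)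
qed

lemma weight: "weight_le K \<tau>"
proof -
  define \<U> where "\<U> = (\<lambda>C. g -` C \<inter> X) ` {{y. agree \<alpha> y s} | (\<alpha>::'k) (s::'k \<Rightarrow> 'k). True}"
  have "|\<U>| \<le>o kappa K"
    unfolding \<U>_def by (rule le_kappa_image[OF le_kappa_cylinders])
  moreover have "openin \<tau> V" if "V \<in> \<U>" for V
    using that openin_cylinder unfolding \<U>_def \<tau>_def openin_pullback_topology by blast
  moreover have "\<exists>V\<in>\<U>. x \<in> V \<and> V \<subseteq> U" if U: "openin \<tau> U" and x: "x \<in> U" for U x
  proof -
    obtain \<alpha> where \<alpha>: "N \<alpha> x \<subseteq> U"
      using U x unfolding openin_\<tau> by blast
    have "N \<alpha> x = g -` {y. agree \<alpha> y (g x)} \<inter> X"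
      by (auto simp: N_def)
    then have "N \<alpha> x \<in> \<U>"
      unfolding \<U>_def by blast
    moreover have "x \<in> X"
      using U x unfolding openin_\<tau> by blast
    ultimately show ?thesis
      using \<alpha> N_self by blast
  qed
  ultimately show ?thesis
    unfolding weight_le_def by blast
qed

lemma additive: "kadditive K \<tau>"
  unfolding kadditive_def
proof (intro allI impI)
  fix \<F> assume \<F>: "(\<forall>U\<in>\<F>. openin \<tau> U) \<and> |\<F>| <o kappa K"
  have "\<exists>\<beta>. N \<beta> x \<subseteq> X \<inter> \<Inter>\<F>" if x: "x \<in> X \<inter> \<Inter>\<F>" for x
  proof -
    have "\<forall>U\<in>\<F>. \<exists>\<alpha>. N \<alpha> x \<subseteq> U"
      using \<F> x unfolding openin_\<tau> by blast
    from bchoice[OF this] obtain \<alpha> where \<alpha>: "\<And>U. U \<in> \<F> \<Longrightarrow> N (\<alpha> U) x \<subseteq> U"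
      by blast
    obtain \<beta> where "\<And>U. U \<in> \<F> \<Longrightarrow> \<alpha> U < \<beta>"
      using bounded_if_small[OF small_image, of \<F> \<alpha>] \<F> by auto
    then have "N \<beta> x \<subseteq> U" if "U \<in> \<F>" for U
      using that \<alpha> N_antimono[OF less_imp_le] by blast
    moreover have "N \<beta> x \<subseteq> X"
      by (auto simp: N_def)
    ultimately show ?thesis
      by blast
  qed
  then show "openin \<tau> (topspace \<tau> \<inter> \<Inter>\<F>)"
    unfolding openin_\<tau> by simp
qed

text \<open>
  II answers \<open>(U, x)\<close> by the largest cylinder neighbourhood of \<open>x\<close> inside \<open>U\<close>. All answers are then
  open in the whole space, and by additivity so are the positions and the moves of I.
\<close>

definition depth :: "'a set \<times> 'a \<Rightarrow> 'k"
  where "depth p = (LEAST \<delta>. N \<delta> (snd p) \<subseteq> fst p)"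

definition reply :: "('k, 'a) strategy"
  where "reply \<alpha> m = N (depth (m \<alpha>)) (snd (m \<alpha>))"

lemma reply_run:
  assumes run: "run_by \<tau> reply m V D" and \<alpha>: "\<alpha> \<in> D" and D: "{..\<alpha>} \<subseteq> D"
  shows "V \<alpha> = N (depth (m \<alpha>)) (snd (m \<alpha>))" and "snd (m \<alpha>) \<in> X" and "V \<alpha> \<subseteq> fst (m \<alpha>)"
    and "fst (m \<alpha>) \<subseteq> meet \<tau> V {..<\<alpha>}" and "legal_II \<tau> m V \<alpha>"
proof -
  have reply: "V \<beta> = N (depth (m \<beta>)) (snd (m \<beta>))" if "\<beta> \<le> \<alpha>" for \<beta>
    using run D that by (auto simp: run_by_def reply_def)
  then show V: "V \<alpha> = N (depth (m \<alpha>)) (snd (m \<alpha>))"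
    by simp
  have legal: "openin (subtopology \<tau> (meet \<tau> V {..<\<alpha>})) (fst (m \<alpha>))" "snd (m \<alpha>) \<in> fst (m \<alpha>)"
    using run \<alpha> by (auto simp: run_by_def legal_I_def)
  have "\<forall>U\<in>V ` {..<\<alpha>}. openin \<tau> U"
    using reply openin_N by auto
  then have "openin \<tau> (topspace \<tau> \<inter> \<Inter>(V ` {..<\<alpha>}))"
    using additive[unfolded kadditive_def, THEN spec, of "V ` {..<\<alpha>}"]
      small_image[OF card_initial_segment, of V \<alpha>] by simp
  then have meet: "openin \<tau> (meet \<tau> V {..<\<alpha>})"
    by (simp add: meet_def)
  then have U: "openin \<tau> (fst (m \<alpha>))" "fst (m \<alpha>) \<subseteq> meet \<tau> V {..<\<alpha>}"
    using legal(1) by (simp_all add: openin_open_subtopology)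
  then show "fst (m \<alpha>) \<subseteq> meet \<tau> V {..<\<alpha>}"
    by blast
  show x: "snd (m \<alpha>) \<in> X"
    using U(1) legal(2) unfolding openin_\<tau> by blast
  have "\<exists>\<delta>. N \<delta> (snd (m \<alpha>)) \<subseteq> fst (m \<alpha>)"
    using U(1) legal(2) unfolding openin_\<tau> by blast
  then have "N (depth (m \<alpha>)) (snd (m \<alpha>)) \<subseteq> fst (m \<alpha>)"
    unfolding depth_def by (rule LeastI_ex)
  then show sub: "V \<alpha> \<subseteq> fst (m \<alpha>)"
    by (simp add: V)
  have "openin (subtopology \<tau> (meet \<tau> V {..<\<alpha>})) (V \<alpha>)"
    using openin_open_subtopology[OF meet] sub U(2) openin_N by (simp add: V)
  then show "legal_II \<tau> m V \<alpha>"
    using sub N_self[OF x] by (simp add: legal_II_def V)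
qed

text \<open>
  A point played by I agrees with every earlier one on the initial segment that was fixed by the
  answer to the earlier one. So these segments fit together to a sequence \<open>y\<close>. Each of them extends into \<open>g ` X\<close>, so by superclosedness some element of
  \<open>g ` X\<close> lies in all answers. The argument does not distinguish runs of length \<open>\<gamma> < \<kappa>\<close> from full runs.
\<close>

lemma reply_meet:
  assumes run: "run_by \<tau> reply m V D" and D: "D \<noteq> {}" "\<And>\<alpha>. \<alpha> \<in> D \<Longrightarrow> {..\<alpha>} \<subseteq> D"
  shows "meet \<tau> V D \<noteq> {}"
proof -
  define x where "x \<alpha> = snd (m \<alpha>)" for \<alpha>
  define \<delta> where "\<delta> \<alpha> = depth (m \<alpha>)" for \<alpha>
  have V: "V \<alpha> = N (\<delta> \<alpha>) (x \<alpha>)" and x: "x \<alpha> \<in> X" if "\<alpha> \<in> D" for \<alpha>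
    using reply_run[OF run that D(2)[OF that]] by (simp_all add: x_def \<delta>_def)
  have later: "agree (\<delta> \<alpha>) (g (x \<beta>)) (g (x \<alpha>))" if "\<alpha> \<in> D" "\<beta> \<in> D" "\<alpha> < \<beta>" for \<alpha> \<beta>
  proof -
    have "x \<beta> \<in> V \<beta>"
      using V[OF that(2)] x[OF that(2)] N_self by simp
    then have "x \<beta> \<in> V \<alpha>"
      using reply_run(3,4)[OF run that(2) D(2)[OF that(2)]] that(3) unfolding meet_def by blast
    then show ?thesis
      using V[OF that(1)] by (simp add: N_def)
  qed
  have consistent: "g (x \<beta>) \<eta> = g (x \<alpha>) \<eta>" if "\<alpha> \<in> D" "\<beta> \<in> D" "\<eta> < \<delta> \<alpha>" "\<eta> < \<delta> \<beta>" for \<alpha> \<beta> \<eta>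
    using later[OF that(1,2)] later[OF that(2,1)] that(3,4)
    by (cases \<alpha> \<beta> rule: linorder_cases) (auto simp: agree_def)
  define y where "y \<eta> = g (x (SOME \<alpha>. \<alpha> \<in> D \<and> \<eta> < \<delta> \<alpha>)) \<eta>" for \<eta>
  have y: "agree (\<delta> \<alpha>) (g (x \<alpha>)) y" if \<alpha>: "\<alpha> \<in> D" for \<alpha>
    unfolding agree_def
  proof (intro allI impI)
    fix \<eta> assume \<eta>: "\<eta> < \<delta> \<alpha>"
    define \<beta> where "\<beta> = (SOME \<alpha>. \<alpha> \<in> D \<and> \<eta> < \<delta> \<alpha>)"
    have "\<exists>\<alpha>. \<alpha> \<in> D \<and> \<eta> < \<delta> \<alpha>"
      using \<alpha> \<eta> by blast
    then have "\<beta> \<in> D \<and> \<eta> < \<delta> \<beta>"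
      unfolding \<beta>_def by (rule someI_ex)
    then show "g (x \<alpha>) \<eta> = y \<eta>"
      using consistent[of \<beta> \<alpha> \<eta>] \<alpha> \<eta> by (simp add: y_def \<beta>_def)
  qed
  have "\<delta> ` D \<noteq> {} \<and> (\<forall>e\<in>\<delta> ` D. \<exists>p\<in>g ` X. agree e p y)"
  proof (intro conjI ballI)
    fix e assume "e \<in> \<delta> ` D"
    then obtain \<alpha> where "\<alpha> \<in> D" "e = \<delta> \<alpha>"
      by blast
    then show "\<exists>p\<in>g ` X. agree e p y"
      using x y by (intro bexI[of _ "g (x \<alpha>)"]) simp_all
  qed (use D(1) in simp)
  then have "\<exists>p\<in>g ` X. \<forall>e\<in>\<delta> ` D. agree e p y"
    by (rule superclosed[unfolded superclosed_def, THEN spec, THEN spec, THEN mp])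
  then obtain z where z: "z \<in> X" "\<And>\<alpha>. \<alpha> \<in> D \<Longrightarrow> agree (\<delta> \<alpha>) (g z) y"
    by auto
  have "z \<in> V \<alpha>" if "\<alpha> \<in> D" for \<alpha>
    using agree_trans[OF z(2)[OF that] agree_sym[OF y[OF that]]] z(1) V[OF that] by (simp add: N_def)
  then have "z \<in> meet \<tau> V D"
    using z(1) by (simp add: meet_def)
  then show ?thesis
    by blast
qed

lemma winning: "winning_strong \<tau> reply"
  unfolding winning_strong_def
proof (intro conjI allI impI)
  show "legal_strategy \<tau> reply"
    unfolding legal_strategy_def
  proof (intro allI impI)
    fix m V \<alpha> assume "run_by \<tau> reply m V {..\<alpha>}"
    then show "legal_II \<tau> m V \<alpha>"
      by (rule reply_run(5)) auto
  qed
  show "meet \<tau> V {..<\<gamma>} \<noteq> {}" if "is_limit \<gamma> \<and> run_by \<tau> reply m V {..<\<gamma>}" for m V \<gamma>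
    by (rule reply_meet[of m V]) (use that in \<open>auto simp: is_limit_def\<close>)
  show "meet \<tau> V UNIV \<noteq> {}" if "run_by \<tau> reply m V UNIV" for m V
    by (rule reply_meet[of m V, OF that]) auto
qed

lemma SC: "SC_space K \<tau>"
  unfolding SC_space_def using regular Hausdorff weight winning by blast

end

lemma (in admissible_cardinal) standard_imp_additive_SC:
  assumes space: "kBorel_space K X \<B>" and standard: "standard_kBorel K X \<B>"
  shows "\<exists>\<tau>. topspace \<tau> = X \<and> kadditive K \<tau> \<and> SC_space K \<tau> \<and> Bor K \<tau> = \<B>"
proof -
  obtain g where g: "represents g X \<B>" "superclosed (g ` X)"
    using superclosed_representation[OF space standard] by blast
  interpret superclosed_space K X g
    using g by unfold_locales (auto simp: represents_def)
  have "Bor K \<tau> = \<B>"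
    using g(1) Bor_pullback_topology[of X g bounded_topology] by (simp add: \<tau>_def represents_def)
  then show ?thesis
    using additive SC topspace_\<tau> by blast
qed

lemma SC_imp_fSC: "SC_space K \<tau> \<Longrightarrow> fSC_space K \<tau>"
  unfolding SC_space_def fSC_space_def winning_strong_def winning_fair_def by blast

theorem theorem4p5:
  fixes X :: "'a set" and \<B> :: "'a set set"
  assumes "admissible TYPE('k::wellorder)"
    and "kBorel_space TYPE('k) X \<B>"
  shows "(standard_kBorel TYPE('k) X \<B> \<longleftrightarrow>
           (\<exists>\<tau>. topspace \<tau> = X \<and> regular_space \<tau> \<and> Hausdorff_space \<tau> \<and>
                fSC_space TYPE('k) \<tau> \<and> Bor TYPE('k) \<tau> = \<B>)) \<and>
         (standard_kBorel TYPE('k) X \<B> \<longleftrightarrow>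
           (\<exists>\<tau>. topspace \<tau> = X \<and> regular_space \<tau> \<and> Hausdorff_space \<tau> \<and>
                kadditive TYPE('k) \<tau> \<and> SC_space TYPE('k) \<tau> \<and> Bor TYPE('k) \<tau> = \<B>))"
proof -
  interpret admissible_cardinal "TYPE('k)"
    using assms(1) by unfold_locales
  let ?standard = "standard_kBorel TYPE('k) X \<B>"
  let ?fair = "\<exists>\<tau>. topspace \<tau> = X \<and> regular_space \<tau> \<and> Hausdorff_space \<tau> \<and>
    fSC_space TYPE('k) \<tau> \<and> Bor TYPE('k) \<tau> = \<B>"
  let ?strong = "\<exists>\<tau>. topspace \<tau> = X \<and> regular_space \<tau> \<and> Hausdorff_space \<tau> \<and>
    kadditive TYPE('k) \<tau> \<and> SC_space TYPE('k) \<tau> \<and> Bor TYPE('k) \<tau> = \<B>"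
  have "?strong" if standard: ?standard
  proof -
    obtain \<tau> where \<tau>: "topspace \<tau> = X" "kadditive TYPE('k) \<tau>" "SC_space TYPE('k) \<tau>" "Bor TYPE('k) \<tau> = \<B>"
      using standard_imp_additive_SC[OF assms(2) standard] by blast
    moreover have "regular_space \<tau>" "Hausdorff_space \<tau>"
      using \<tau>(3) unfolding SC_space_def by blast+
    ultimately show ?thesis
      by blast
  qed
  moreover have "?fair" if ?strong
    using that SC_imp_fSC by blast
  moreover have "?standard" if ?fair
    using that fSC_imp_standard by blast
  ultimately show ?thesis
    by blast
qed

end
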